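(* Let $H$ be a Halin graph. Then $AT(H)=4$ if $H$ is a wheel of even order, and $AT(H)=3$ otherwise.
   Context: All graphs are finite and simple. A Halin graph $H=T\cup C_n$ is a plane graph obtained from a plane tree $T$ having no vertex of degree two and at least one vertex of degree at least three, by adding a cycle $C_n$ that connects all the leaves (pendant vertices) of $T$ in the cyclic order determined by the planar drawing of $T$. The vertices of $C_n$ are called outer vertices and the others inner vertices. A wheel is a Halin graph with exactly one inner vertex; its order is its total number of vertices. For a digraph $D$, an Eulerian subdigraph is a spanning subdigraph (i.e. a subset of the arcs, possibly empty, on all vertices) in which every vertex has indegree equal to outdegree; it is even or odd according to the parity of its number of arcs. The Alon–Tarsi number $AT(G)$ of a graph $G$ is the smallest integer $k$ such that $G$ has an orientation $D$ with maximum outdegree at most $k-1$ for which the number of even Eulerian subdigraphs of $D$ differs from the number of odd Eulerian subdigraphs of $D$. *)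

theory Defs
  imports Main
begin

text \<open>Simple graphs: a finite vertex set V and a set E of 2-element subsets of V.\<close>

definition simple_graph :: "'a set \<Rightarrow> 'a set set \<Rightarrow> bool" where
  "simple_graph V E \<longleftrightarrow> finite V \<and>
     (\<forall>e\<in>E. \<exists>u v. e = {u, v} \<and> u \<noteq> v \<and> u \<in> V \<and> v \<in> V)"

definition nbrs :: "'a set set \<Rightarrow> 'a \<Rightarrow> 'a set" where
  "nbrs E v = {u. {u, v} \<in> E}"

definition deg :: "'a set set \<Rightarrow> 'a \<Rightarrow> nat" where
  "deg E v = card (nbrs E v)"

definition connected_graph :: "'a set \<Rightarrow> 'a set set \<Rightarrow> bool" where
  "connected_graph V E \<longleftrightarrow>
     (\<forall>u\<in>V. \<forall>v\<in>V. (u, v) \<in> {(x, y). {x, y} \<in> E}\<^sup>*)"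

text \<open>A tree: a nonempty connected simple graph with |V| - 1 edges.\<close>
definition is_tree :: "'a set \<Rightarrow> 'a set set \<Rightarrow> bool" where
  "is_tree V T \<longleftrightarrow> simple_graph V T \<and> V \<noteq> {} \<and> connected_graph V T \<and> card T + 1 = card V"

definition leaves :: "'a set \<Rightarrow> 'a set set \<Rightarrow> 'a set" where
  "leaves V T = {v \<in> V. deg T v = 1}"

text \<open>A plane tree is given combinatorially by a rotation system: at every vertex v,
  rho v is a cyclic permutation of the neighbours of v.\<close>
definition rotation_system :: "'a set \<Rightarrow> 'a set set \<Rightarrow> ('a \<Rightarrow> 'a \<Rightarrow> 'a) \<Rightarrow> bool" where
  "rotation_system V T rho \<longleftrightarrow>
     (\<forall>v\<in>V. bij_betw (rho v) (nbrs T v) (nbrs T v) \<and>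
        (\<forall>u\<in>nbrs T v. \<forall>w\<in>nbrs T v. \<exists>k. (rho v ^^ k) u = w))"

text \<open>One step of the boundary walk of the (unique) face of the plane tree,
  on darts (u,v): arriving at v from u, leave along the next edge around v.\<close>
definition face_step :: "('a \<Rightarrow> 'a \<Rightarrow> 'a) \<Rightarrow> 'a \<times> 'a \<Rightarrow> 'a \<times> 'a" where
  "face_step rho d = (snd d, rho (snd d) (fst d))"

text \<open>l' is the leaf following leaf l in the cyclic order of leaves determined by the
  planar drawing: the next leaf reached on the boundary walk starting from l.\<close>
definition leaf_succ :: "'a set \<Rightarrow> 'a set set \<Rightarrow> ('a \<Rightarrow> 'a \<Rightarrow> 'a) \<Rightarrow> 'a \<Rightarrow> 'a \<Rightarrow> bool" where
  "leaf_succ V T rho l l' \<longleftrightarrow> l \<in> leaves V T \<and>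
     (\<exists>p k. {l, p} \<in> T \<and> k > 0 \<and> snd ((face_step rho ^^ k) (l, p)) = l' \<and> l' \<in> leaves V T \<and>
        (\<forall>j. 0 < j \<and> j < k \<longrightarrow> snd ((face_step rho ^^ j) (l, p)) \<notin> leaves V T))"

definition leaf_cycle :: "'a set \<Rightarrow> 'a set set \<Rightarrow> ('a \<Rightarrow> 'a \<Rightarrow> 'a) \<Rightarrow> 'a set set" where
  "leaf_cycle V T rho = {{l, l'} | l l'. leaf_succ V T rho l l'}"

text \<open>(T, rho) is a Halin decomposition of the graph (V,E): T is a plane spanning tree
  with no vertex of degree 2 and some vertex of degree at least 3, and E consists of
  the edges of T together with the cycle through the leaves in their cyclic order.\<close>
definition halin_decomp :: "'a set \<Rightarrow> 'a set set \<Rightarrow> 'a set set \<Rightarrow> ('a \<Rightarrow> 'a \<Rightarrow> 'a) \<Rightarrow> bool" where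
  "halin_decomp V E T rho \<longleftrightarrow>
     is_tree V T \<and> rotation_system V T rho \<and>
     (\<forall>v\<in>V. deg T v \<noteq> 2) \<and> (\<exists>v\<in>V. deg T v \<ge> 3) \<and>
     E = T \<union> leaf_cycle V T rho"

definition halin :: "'a set \<Rightarrow> 'a set set \<Rightarrow> bool" where
  "halin V E \<longleftrightarrow> (\<exists>T rho. halin_decomp V E T rho)"

text \<open>A wheel: a Halin graph with exactly one inner (non-leaf) vertex.\<close>
definition wheel :: "'a set \<Rightarrow> 'a set set \<Rightarrow> bool" where
  "wheel V E \<longleftrightarrow> (\<exists>T rho. halin_decomp V E T rho \<and> card (V - leaves V T) = 1)"

text \<open>Orientations, Eulerian subdigraphs, Alon--Tarsi number.\<close>
definition orientation :: "'a set set \<Rightarrow> ('a \<times> 'a) set \<Rightarrow> bool" where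
  "orientation E D \<longleftrightarrow> (\<forall>(u, v)\<in>D. {u, v} \<in> E) \<and>
     (\<forall>u v. {u, v} \<in> E \<longrightarrow> ((u, v) \<in> D \<longleftrightarrow> (v, u) \<notin> D))"

definition outdeg :: "('a \<times> 'a) set \<Rightarrow> 'a \<Rightarrow> nat" where
  "outdeg D v = card {w. (v, w) \<in> D}"

definition indeg :: "('a \<times> 'a) set \<Rightarrow> 'a \<Rightarrow> nat" where
  "indeg D v = card {u. (u, v) \<in> D}"

definition eulerian_sub :: "'a set \<Rightarrow> ('a \<times> 'a) set \<Rightarrow> ('a \<times> 'a) set \<Rightarrow> bool" where
  "eulerian_sub V D S \<longleftrightarrow> S \<subseteq> D \<and> (\<forall>v\<in>V. indeg S v = outdeg S v)"

definition even_eulerian :: "'a set \<Rightarrow> ('a \<times> 'a) set \<Rightarrow> nat" where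
  "even_eulerian V D = card {S. eulerian_sub V D S \<and> even (card S)}"

definition odd_eulerian :: "'a set \<Rightarrow> ('a \<times> 'a) set \<Rightarrow> nat" where
  "odd_eulerian V D = card {S. eulerian_sub V D S \<and> odd (card S)}"

text \<open>AT(G): least k such that some orientation has maximum outdegree at most k-1
  (i.e. all outdegrees < k) and different numbers of even and odd Eulerian subdigraphs.\<close>
definition alon_tarsi :: "'a set \<Rightarrow> 'a set set \<Rightarrow> nat" where
  "alon_tarsi V E = (LEAST k. \<exists>D. orientation E D \<and> (\<forall>v\<in>V. outdeg D v < k) \<and>
       even_eulerian V D \<noteq> odd_eulerian V D)"

end

theory Submission
  imports Defs "HOL-Library.FuncSet"
begin

text \<open>
  Orient the leaf cycle cyclically and the tree towards a leaf \<open>x\<close>. All outdegrees are at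
  most 2, and every nonempty Eulerian subdigraph is a single directed cycle through \<open>x\<close>: it follows
  the leaf cycle up to some leaf and returns to \<open>x\<close> through the tree, or it is the whole leaf
  cycle. So there are \<open>1 + n\<close> Eulerian subdigraphs for \<open>n\<close> leaves, and if \<open>n\<close> is even their
  number is odd, whence the even and odd ones cannot balance. If \<open>n\<close> is odd and there are two inner
  vertices, cut the tree at an edge \<open>ab\<close> between inner vertices. One side, say that of \<open>a\<close>, has an
  even number \<open>m\<close> of leaves; orient it towards one of its leaves \<open>x\<close>, orient the other side
  towards \<open>b\<close>, and add the arc \<open>(a, b)\<close>. Nothing returns from the sink side, so only leaves on the
  side of \<open>a\<close> are possible exits and the number of Eulerian subdigraphs is \<open>1 + m\<close>.

  For wheels with an odd rim, Alon--Tarsi's colouring theorem for three colours gives the lower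
  bound, and an acyclic orientation the upper bound 4. Everywhere else, outdegrees at most 1 are
  impossible because there are more edges than vertices.
\<close>

section \<open>Eulerian subdigraphs and colourings\<close>

lemma finite_arcs:
  assumes "finite V" "D \<subseteq> V \<times> V"
  shows "finite D"
  using assms by (meson finite_SigmaI finite_subset)

lemma finite_eulerian_subs: "finite D \<Longrightarrow> finite {S. eulerian_sub V D S}"
  by (rule finite_subset[of _ "Pow D"]) (auto simp: eulerian_sub_def)

lemma eulerian_subs_split:
  fixes V :: "'a set"
  assumes "finite D"
  defines "P \<equiv> {S. eulerian_sub V D S \<and> even (card S)}"
    and "Q \<equiv> {S. eulerian_sub V D S \<and> odd (card S)}"
  shows "{S. eulerian_sub V D S} = P \<union> Q" "finite P" "finite Q" "P \<inter> Q = {}"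
  using finite_eulerian_subs[OF assms(1), of V]
  by (auto simp: P_def Q_def elim: rev_finite_subset)

lemma sum_sign_eulerian_subs:
  assumes "finite D"
  shows "(\<Sum>S | eulerian_sub V D S. (- 1 :: int) ^ card S)
       = int (even_eulerian V D) - int (odd_eulerian V D)"
  unfolding eulerian_subs_split(1)[OF assms]
  by (subst sum.union_disjoint[OF eulerian_subs_split(2-4)[OF assms]])
    (simp add: even_eulerian_def odd_eulerian_def)

text \<open>The two counts add up to the total, so an odd total rules out equality. Every
  orientation constructed below is certified by this parity argument.\<close>

lemma even_ne_odd_eulerian:
  assumes "finite D" "odd (card {S. eulerian_sub V D S})"
  shows "even_eulerian V D \<noteq> odd_eulerian V D"
proof -
  have "card {S. eulerian_sub V D S} = even_eulerian V D + odd_eulerian V D"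
    unfolding eulerian_subs_split(1)[OF assms(1)] even_eulerian_def odd_eulerian_def
    by (rule card_Un_disjoint[OF eulerian_subs_split(2-4)[OF assms(1)]])
  with assms(2) show ?thesis by auto
qed

lemma outdeg_eq_sum:
  assumes "finite V" "S \<subseteq> V \<times> V" "v \<in> V"
  shows "outdeg S v = (\<Sum>d\<in>S. if fst d = v then 1 else 0)"
proof -
  have "finite S" using assms finite_arcs by blast
  then have "(\<Sum>d\<in>S. if fst d = v then 1 else 0) = card {d\<in>S. fst d = v}"
    by (simp flip: sum.inter_filter)
  also have "{d\<in>S. fst d = v} = Pair v ` {w. (v, w) \<in> S}" by auto
  also have "card \<dots> = outdeg S v"
    unfolding outdeg_def by (rule card_image) (auto simp: inj_on_def)
  finally show ?thesis by simp
qed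

lemma indeg_eq_sum:
  assumes "finite V" "S \<subseteq> V \<times> V" "v \<in> V"
  shows "indeg S v = (\<Sum>d\<in>S. if snd d = v then 1 else 0)"
proof -
  have "finite S" using assms finite_arcs by blast
  then have "(\<Sum>d\<in>S. if snd d = v then 1 else 0) = card {d\<in>S. snd d = v}"
    by (simp flip: sum.inter_filter)
  also have "{d\<in>S. snd d = v} = (\<lambda>u. (u, v)) ` {w. (w, v) \<in> S}" by auto
  also have "card \<dots> = indeg S v"
    unfolding indeg_def by (rule card_image) (auto simp: inj_on_def)
  finally show ?thesis by simp
qed

lemma sum_outdeg:
  assumes "finite V" "S \<subseteq> V \<times> V"
  shows "(\<Sum>v\<in>V. outdeg S v) = card S"
proof -
  have "(\<Sum>v\<in>V. outdeg S v) = (\<Sum>v\<in>V. \<Sum>d\<in>S. if fst d = v then 1 else 0)"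
    using assms by (simp add: outdeg_eq_sum)
  also have "\<dots> = (\<Sum>d\<in>S. \<Sum>v\<in>V. if fst d = v then 1 else 0)" by (rule sum.swap)
  also have "\<dots> = (\<Sum>d\<in>S. 1)"
    using assms by (intro sum.cong) auto
  finally show ?thesis by simp
qed

lemma sum_indeg:
  assumes "finite V" "S \<subseteq> V \<times> V"
  shows "(\<Sum>v\<in>V. indeg S v) = card S"
proof -
  have "(\<Sum>v\<in>V. indeg S v) = (\<Sum>v\<in>V. \<Sum>d\<in>S. if snd d = v then 1 else 0)"
    using assms by (simp add: indeg_eq_sum)
  also have "\<dots> = (\<Sum>d\<in>S. \<Sum>v\<in>V. if snd d = v then 1 else 0)" by (rule sum.swap)
  also have "\<dots> = (\<Sum>d\<in>S. 1)"
    using assms by (intro sum.cong) auto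
  finally show ?thesis by simp
qed

text \<open>The \<open>d\<close>-th forward difference of the function t^j at 0. The exponent
  \<open>d + t\<close> has the parity of d - t and avoids truncated subtraction.\<close>

definition diff_moment :: "nat \<Rightarrow> nat \<Rightarrow> int" where
  "diff_moment d j = (\<Sum>t\<le>d. (- 1) ^ (d + t) * int (d choose t) * int t ^ j)"

text \<open>The term for t = 0 vanishes, the absorption identity for binomials trades one factor
  \<open>Suc t\<close> for \<open>Suc d\<close>, and the shifted power (t + 1)^j is expanded
  binomially.\<close>

lemma diff_moment_Suc:
  "diff_moment (Suc d) (Suc j) = int (Suc d) * (\<Sum>i\<le>j. int (j choose i) * diff_moment d i)"
proof -
  have "diff_moment (Suc d) (Suc j)
      = (\<Sum>t\<le>d. (- 1) ^ (Suc d + Suc t) * int (Suc d choose Suc t) * int (Suc t) ^ Suc j)"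
    unfolding diff_moment_def by (subst sum.atMost_Suc_shift) simp
  also have "\<dots> = (\<Sum>t\<le>d. int (Suc d) * ((- 1) ^ (d + t) * int (d choose t) * (int t + 1) ^ j))"
  proof (rule sum.cong[OF refl])
    fix t
    have "int (Suc d choose Suc t) * int (Suc t) = int (Suc d) * int (d choose t)"
      by (metis Suc_times_binomial mult.commute of_nat_mult)
    moreover have "(- 1) ^ (Suc d + Suc t) = (- 1 :: int) ^ (d + t)" by simp
    moreover have "s * a * x ^ Suc j = b * (s * c * x ^ j)" if "a * x = b * c" for s a x b c :: int
    proof -
      have "s * a * x ^ Suc j = s * (a * x) * x ^ j" by (simp add: mult.assoc)
      also have "\<dots> = b * (s * c * x ^ j)" by (simp only: that mult_ac)
      finally show ?thesis .
    qed
    moreover have "int (Suc t) = int t + 1" by simp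
    ultimately show "(- 1) ^ (Suc d + Suc t) * int (Suc d choose Suc t) * int (Suc t) ^ Suc j
      = int (Suc d) * ((- 1) ^ (d + t) * int (d choose t) * (int t + 1) ^ j)"
      by metis
  qed
  also have "\<dots> = int (Suc d) * (\<Sum>t\<le>d. \<Sum>i\<le>j. int (j choose i) *
      ((- 1) ^ (d + t) * int (d choose t) * int t ^ i))"
    by (simp add: binomial_ring sum_distrib_left mult_ac)
  also have "\<dots> = int (Suc d) * (\<Sum>i\<le>j. int (j choose i) * diff_moment d i)"
    unfolding diff_moment_def by (subst sum.swap) (simp add: sum_distrib_left)
  finally show ?thesis .
qed

lemma diff_moment_0: "d > 0 \<Longrightarrow> diff_moment d 0 = 0"
  using choose_alternating_sum[of d, where 'a = int]
  by (simp add: diff_moment_def power_add mult.assoc flip: sum_distrib_left)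

text \<open>A \<open>d\<close>-th difference kills powers below \<open>d\<close> and sends the
  \<open>d\<close>-th power to \<open>fact d\<close>. In the recursion the induction hypothesis
  leaves at most the summand with index \<open>d\<close>.\<close>

lemma diff_moment_eq: "j \<le> d \<Longrightarrow> diff_moment d j = (if j = d then fact d else 0)"
proof (induction d arbitrary: j)
  case 0
  then show ?case by (simp add: diff_moment_def)
next
  case (Suc d)
  show ?case
  proof (cases j)
    case 0
    then show ?thesis by (simp add: diff_moment_0)
  next
    case (Suc i)
    have "(\<Sum>k\<le>i. int (i choose k) * diff_moment d k)
        = (\<Sum>k\<le>i. if k = d then int (i choose k) * fact d else 0)"
      using Suc.IH Suc.prems Suc by (intro sum.cong) auto
    then show ?thesis
      using Suc Suc.prems by (auto simp: diff_moment_Suc)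
  qed
qed

text \<open>The Alon--Tarsi theorem. The signed sum over all maps \<open>c\<close> from \<open>V\<close> to \<open>{..<k}\<close>
  of the graph polynomial \<open>\<Prod>(c u - c v)\<close>, weighted by finite-difference coefficients of
  order \<open>outdeg v\<close>, extracts the coefficient of \<open>\<Prod>c v ^ outdeg v\<close>. That coefficient
  is the difference of the two Eulerian counts, and every summand vanishes.\<close>

lemma eulerian_balanced_if_not_colourable:
  assumes "finite V" "D \<subseteq> V \<times> V"
    and out: "\<And>v. v \<in> V \<Longrightarrow> outdeg D v < k"
    and col: "\<And>c :: 'a \<Rightarrow> nat. (\<And>v. v \<in> V \<Longrightarrow> c v < k) \<Longrightarrow> \<exists>(u, v)\<in>D. c u = c v"
  shows "even_eulerian V D = odd_eulerian V D"
proof -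
  have finD: "finite D" using assms finite_arcs by blast
  define C where "C = PiE V (\<lambda>_. {..<k})"
  \<comment> \<open>These weights turn summation over the value of \<open>c v\<close> into a finite
    difference of order \<open>outdeg D v\<close>.\<close>
  define w where "w = (\<lambda>v t. (- 1 :: int) ^ (outdeg D v + t) * int (outdeg D v choose t))"
  \<comment> \<open>Expanding the product over arcs picks the head for arcs in \<open>S\<close> and
    the tail for the others; \<open>e S v\<close> is the resulting exponent of \<open>c v\<close>.
    It agrees with \<open>outdeg D v\<close> at every vertex exactly when \<open>S\<close> is
    Eulerian.\<close>
  define e where "e = (\<lambda>S v. indeg S v + outdeg (D - S) v)"
  have split: "outdeg S v + outdeg (D - S) v = outdeg D v" if "S \<subseteq> D" "v \<in> V" for S v
  proof -
    have "S \<subseteq> V \<times> V" "D - S \<subseteq> V \<times> V" using that assms by auto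
    moreover have "(\<Sum>d\<in>S. if fst d = v then 1 else 0 :: nat) + (\<Sum>d\<in>D - S. if fst d = v then 1 else 0)
      = (\<Sum>d\<in>D. if fst d = v then 1 else 0)"
      using that finD by (metis add.commute sum.subset_diff)
    ultimately show ?thesis using that assms by (simp add: outdeg_eq_sum)
  qed
  have sum_e: "(\<Sum>v\<in>V. e S v) = (\<Sum>v\<in>V. outdeg D v)" if "S \<subseteq> D" for S
  proof -
    have sub: "S \<subseteq> V \<times> V" using that assms by auto
    have "(\<Sum>v\<in>V. e S v) = (\<Sum>v\<in>V. indeg S v) + (\<Sum>v\<in>V. outdeg (D - S) v)"
      by (simp add: e_def sum.distrib)
    also have "\<dots> = (\<Sum>v\<in>V. outdeg S v) + (\<Sum>v\<in>V. outdeg (D - S) v)"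
      using assms(1) sub by (simp add: sum_indeg sum_outdeg)
    also have "\<dots> = (\<Sum>v\<in>V. outdeg D v)"
      using split[OF that] by (simp flip: sum.distrib)
    finally show ?thesis .
  qed
  have monom: "(\<Prod>d\<in>S. - int (c (snd d))) * (\<Prod>d\<in>D - S. int (c (fst d)))
      = (- 1) ^ card S * (\<Prod>v\<in>V. int (c v) ^ e S v)" if "S \<subseteq> D" for S and c :: "'a \<Rightarrow> nat"
  proof -
    have sub: "S \<subseteq> V \<times> V" "D - S \<subseteq> V \<times> V" using that assms by auto
    have "(\<Prod>d\<in>S. int (c (snd d))) = (\<Prod>d\<in>S. \<Prod>v\<in>V. if snd d = v then int (c v) else 1)"
      using sub assms by (intro prod.cong) auto
    also have "\<dots> = (\<Prod>v\<in>V. \<Prod>d\<in>S. int (c v) ^ (if snd d = v then 1 else 0))"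
      by (subst prod.swap) (intro prod.cong, auto)
    also have "\<dots> = (\<Prod>v\<in>V. int (c v) ^ indeg S v)"
      using assms sub by (intro prod.cong) (simp_all add: indeg_eq_sum flip: power_sum)
    finally have 1: "(\<Prod>d\<in>S. int (c (snd d))) = (\<Prod>v\<in>V. int (c v) ^ indeg S v)" .
    have "(\<Prod>d\<in>D - S. int (c (fst d))) = (\<Prod>d\<in>D - S. \<Prod>v\<in>V. if fst d = v then int (c v) else 1)"
      using sub assms by (intro prod.cong) auto
    also have "\<dots> = (\<Prod>v\<in>V. \<Prod>d\<in>D - S. int (c v) ^ (if fst d = v then 1 else 0))"
      by (subst prod.swap) (intro prod.cong, auto)
    also have "\<dots> = (\<Prod>v\<in>V. int (c v) ^ outdeg (D - S) v)"
      using assms sub by (intro prod.cong) (simp_all add: outdeg_eq_sum flip: power_sum)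
    finally have 2: "(\<Prod>d\<in>D - S. int (c (fst d))) = (\<Prod>v\<in>V. int (c v) ^ outdeg (D - S) v)" .
    have "(\<Prod>d\<in>S. - int (c (snd d))) = (- 1) ^ card S * (\<Prod>d\<in>S. int (c (snd d)))"
      by (simp add: prod_uminus)
    then show ?thesis
      by (simp add: 1 2 e_def power_add prod.distrib mult.assoc)
  qed
  \<comment> \<open>The binomial vanishes for t beyond \<open>outdeg D v\<close>, which is below
    \<open>k\<close>, so the sum over all colours is the full difference.\<close>
  have moment: "(\<Sum>t<k. w v t * int t ^ j) = diff_moment (outdeg D v) j" if "v \<in> V" for v j
    unfolding w_def diff_moment_def using out[OF that]
    by (intro sum.mono_neutral_right) (auto simp: binomial_eq_0)
  have coeff: "(\<Sum>c\<in>C. (\<Prod>v\<in>V. w v (c v)) * (\<Prod>v\<in>V. int (c v) ^ e S v))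
      = (if eulerian_sub V D S then (\<Prod>v\<in>V. fact (outdeg D v)) else 0)" if "S \<subseteq> D" for S
  proof -
    have "(\<Sum>c\<in>C. (\<Prod>v\<in>V. w v (c v)) * (\<Prod>v\<in>V. int (c v) ^ e S v))
        = (\<Sum>c\<in>C. \<Prod>v\<in>V. w v (c v) * int (c v) ^ e S v)"
      by (simp add: prod.distrib)
    also have "\<dots> = (\<Prod>v\<in>V. \<Sum>t<k. w v t * int t ^ e S v)"
      unfolding C_def by (rule prod_sum_PiE[symmetric]) (use assms in auto)
    also have "\<dots> = (\<Prod>v\<in>V. diff_moment (outdeg D v) (e S v))"
      by (intro prod.cong) (auto simp: moment)
    also have "\<dots> = (if eulerian_sub V D S then (\<Prod>v\<in>V. fact (outdeg D v)) else 0)"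
    proof (cases "eulerian_sub V D S")
      case True
      then have "e S v = outdeg D v" if "v \<in> V" for v
        using split[OF \<open>S \<subseteq> D\<close> that] that by (auto simp: e_def eulerian_sub_def)
      then show ?thesis using True by (auto simp: diff_moment_eq intro!: prod.cong)
    next
      case False
      then obtain v where v: "v \<in> V" "e S v \<noteq> outdeg D v"
        using split[OF \<open>S \<subseteq> D\<close>] \<open>S \<subseteq> D\<close> by (force simp: e_def eulerian_sub_def)
      \<comment> \<open>By \<open>sum_e\<close> the exponents and the outdegrees have the same
        total, so a discrepancy anywhere forces a deficit somewhere. The difference at that vertex
        is 0.\<close>
      have "\<exists>v\<in>V. e S v < outdeg D v"
      proof (rule ccontr)
        assume "\<not> ?thesis"
        then have ge: "outdeg D v \<le> e S v" if "v \<in> V" for v using that by force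
        then have "(\<Sum>v\<in>V. outdeg D v) < (\<Sum>v\<in>V. e S v)"
          using v ge assms(1) by (intro sum_strict_mono_ex1) (auto intro!: bexI[of _ v] le_neq_implies_less)
        then show False using sum_e[OF \<open>S \<subseteq> D\<close>] by simp
      qed
      then obtain u where u: "u \<in> V" "e S u < outdeg D u" by blast
      then have "diff_moment (outdeg D u) (e S u) = 0" by (simp add: diff_moment_eq)
      then have "(\<Prod>v\<in>V. diff_moment (outdeg D v) (e S v)) = 0"
        using u(1) assms(1) by (meson prod_zero)
      then show ?thesis using False by simp
    qed
    finally show ?thesis .
  qed
  \<comment> \<open>Each colouring has a monochromatic arc, whose factor is 0. The remaining steps
    evaluate the same sum by expanding over subsets of \<open>D\<close>.\<close>
  have "0 = (\<Sum>c\<in>C. (\<Prod>v\<in>V. w v (c v)) * (\<Prod>d\<in>D. - int (c (snd d)) + int (c (fst d))))"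
  proof (rule sum.neutral[symmetric], rule ballI)
    fix c assume "c \<in> C"
    then have "\<exists>(u, v)\<in>D. c u = c v" by (intro col) (auto simp: C_def)
    then have "(\<Prod>d\<in>D. - int (c (snd d)) + int (c (fst d))) = 0"
      using finD by (intro prod_zero) force+
    then show "(\<Prod>v\<in>V. w v (c v)) * (\<Prod>d\<in>D. - int (c (snd d)) + int (c (fst d))) = 0" by simp
  qed
  also have "\<dots> = (\<Sum>c\<in>C. \<Sum>S\<in>Pow D. (- 1) ^ card S *
      ((\<Prod>v\<in>V. w v (c v)) * (\<Prod>v\<in>V. int (c v) ^ e S v)))"
    unfolding prod_add[OF finD] sum_distrib_left
    by (intro sum.cong refl) (simp only: Pow_iff monom mult.left_commute)
  also have "\<dots> = (\<Sum>S\<in>Pow D. (- 1) ^ card S *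
      (\<Sum>c\<in>C. (\<Prod>v\<in>V. w v (c v)) * (\<Prod>v\<in>V. int (c v) ^ e S v)))"
    by (subst sum.swap) (simp add: sum_distrib_left)
  also have "\<dots> = (\<Sum>S\<in>Pow D. if eulerian_sub V D S then
      (- 1) ^ card S * (\<Prod>v\<in>V. fact (outdeg D v)) else 0)"
    by (intro sum.cong) (auto simp: coeff)
  also have "\<dots> = (\<Sum>S | eulerian_sub V D S. (- 1) ^ card S * (\<Prod>v\<in>V. fact (outdeg D v)))"
    using finD by (simp flip: sum.inter_filter) (rule sum.cong, auto simp: eulerian_sub_def)
  also have "\<dots> = (int (even_eulerian V D) - int (odd_eulerian V D)) * (\<Prod>v\<in>V. fact (outdeg D v))"
    by (simp add: sum_sign_eulerian_subs[OF finD] flip: sum_distrib_right)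
  finally show ?thesis using assms(1) by simp
qed

section \<open>A directed ring with a tree attached\<close>

lemma outdeg_pos_iff: "finite S \<Longrightarrow> 0 < outdeg S v \<longleftrightarrow> (\<exists>w. (v, w) \<in> S)"
proof -
  assume "finite S"
  moreover have "{w. (v, w) \<in> S} = snd ` {d \<in> S. fst d = v}" by force
  ultimately have "finite {w. (v, w) \<in> S}" by simp
  then show ?thesis by (auto simp: outdeg_def card_gt_0_iff)
qed

lemma indeg_pos_iff: "finite S \<Longrightarrow> 0 < indeg S v \<longleftrightarrow> (\<exists>u. (u, v) \<in> S)"
proof -
  assume "finite S"
  moreover have "{u. (u, v) \<in> S} = fst ` {d \<in> S. snd d = v}" by force
  ultimately have "finite {u. (u, v) \<in> S}" by simp
  then show ?thesis by (auto simp: indeg_def card_gt_0_iff)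
qed

text \<open>A surjection of a finite set onto itself is a permutation, so each vertex of
  \<open>K\<close> has exactly one arc in and one arc out. Directed cycles will be presented in this
  form.\<close>

lemma eulerian_sub_of_permutation:
  assumes "finite K" "f ` K = K" "(\<lambda>v. (v, f v)) ` K \<subseteq> D"
  shows "eulerian_sub V D ((\<lambda>v. (v, f v)) ` K)"
proof -
  let ?S = "(\<lambda>v. (v, f v)) ` K"
  have inj: "inj_on f K"
    using assms by (simp add: finite_surj_inj)
  have "indeg ?S v = outdeg ?S v" for v
  proof (cases "v \<in> K")
    case True
    then obtain u where u: "u \<in> K" "v = f u" using assms(2) by blast
    then have "{w. (w, v) \<in> ?S} = {u}" using inj by (auto simp: inj_on_def)
    moreover have "{w. (v, w) \<in> ?S} = {f v}" using True by auto
    ultimately show ?thesis by (simp add: indeg_def outdeg_def)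
  next
    case False
    then have "{w. (w, v) \<in> ?S} = {}" "{w. (v, w) \<in> ?S} = {}" using assms(2) by auto
    then show ?thesis by (simp add: indeg_def outdeg_def)
  qed
  then show ?thesis using assms(3) by (simp add: eulerian_sub_def)
qed

lemma card_singleton_filter: "card {w. w = a \<and> P} = of_bool P"
  by (cases P) auto

lemma card_doubleton_filter:
  assumes "a \<noteq> b"
  shows "card {w. w = a \<and> P \<or> w = b \<and> Q} = of_bool P + of_bool Q"
proof -
  have "{w. w = a \<and> P \<or> w = b \<and> Q} = (if P then {a} else {}) \<union> (if Q then {b} else {})" by auto
  then show ?thesis using assms by simp
qed

text \<open>Flow conservation at a vertex with one possible arc in (\<open>P\<close>) and two
  possible arcs out (\<open>Q\<close> and \<open>R\<close>).\<close>

lemma of_bool_eq_plusD: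
  "of_bool P = (of_bool Q + of_bool R :: nat) \<Longrightarrow> (R \<longleftrightarrow> P \<and> \<not> Q) \<and> (Q \<longrightarrow> P)"
  by (cases P; cases Q; cases R) auto

text \<open>Two uses: the whole tree (\<open>A = V\<close>, \<open>R\<close> and \<open>X\<close> empty), or a tree cut at an inner edge
  \<open>ab\<close> (\<open>R = {b}\<close>, \<open>X = {(a, b)}\<close>). The parent map \<open>q\<close> leads to \<open>l 0\<close> inside \<open>A\<close> and to
  \<open>R\<close> outside, and \<open>h\<close> is a rank certifying this.\<close>

locale leaf_ring =
  fixes V A R :: "'a set" and X :: "('a \<times> 'a) set" and l :: "nat \<Rightarrow> 'a" and n :: nat
    and q :: "'a \<Rightarrow> 'a" and h :: "'a \<Rightarrow> nat"
  assumes finite_V: "finite V"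
    and n_ge: "3 \<le> n"
    and inj_l: "inj_on l {..<n}"
    and l_n: "l n = l 0"
    and l_V: "l ` {..<n} \<subseteq> V"
    and A_V: "A \<subseteq> V"
    and root_A: "l 0 \<in> A"
    and R_sub: "R \<subseteq> V - A - l ` {..<n}"
    and X_sub: "X \<subseteq> (A - l ` {..<n}) \<times> R"
    and X_single: "\<And>a b b'. (a, b) \<in> X \<Longrightarrow> (a, b') \<in> X \<Longrightarrow> b = b'"
    and q_V: "\<And>v. v \<in> V - {l 0} - R \<Longrightarrow> q v \<in> V"
    and h_q: "\<And>v. v \<in> V - {l 0} - R \<Longrightarrow> h (q v) < h v"
    and q_A: "\<And>v. v \<in> V - {l 0} - R \<Longrightarrow> q v \<in> A \<longleftrightarrow> v \<in> A"
    and q_leaf: "\<And>v. v \<in> V - {l 0} - R \<Longrightarrow> q v \<in> l ` {..<n} \<Longrightarrow> q v = l 0 \<and> v \<notin> l ` {..<n}"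
begin

abbreviation "L \<equiv> l ` {..<n}"
abbreviation "M \<equiv> V - {l 0} - R"

definition D :: "('a \<times> 'a) set" where
  "D = (\<lambda>i. (l i, l (Suc i))) ` {..<n} \<union> (\<lambda>v. (v, q v)) ` M \<union> X"

lemma l_eq_iff: "i < n \<Longrightarrow> j < n \<Longrightarrow> l i = l j \<longleftrightarrow> i = j"
  using inj_l by (auto simp: inj_on_def)

lemma l_Suc_cases:
  assumes "i < n"
  obtains j where "j < n" "l (Suc i) = l j" "j = (if Suc i = n then 0 else Suc i)"
proof -
  show ?thesis
    using assms l_n n_ge by (intro that[of "if Suc i = n then 0 else Suc i"]) auto
qed

lemma l_Suc_in: "i < n \<Longrightarrow> l (Suc i) \<in> L"
  by (metis l_Suc_cases imageI lessThan_iff)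

lemma D_sub: "D \<subseteq> V \<times> V"
  using l_V l_Suc_in q_V X_sub R_sub A_V by (auto simp: D_def)

lemma finite_D: "finite D"
  using finite_arcs[OF finite_V D_sub] .

text \<open>The guard \<open>0 < i\<close> is there because \<open>l 0\<close> is a root and has no
  parent arc.\<close>

lemma out_leaf: "i < n \<Longrightarrow> (l i, w) \<in> D \<longleftrightarrow> w = l (Suc i) \<or> (0 < i \<and> w = q (l i))"
proof -
  assume i: "i < n"
  have M: "l i \<in> M" if "0 < i" using i that l_V R_sub l_eq_iff[of i 0] by auto
  have "l i \<notin> M" if "i = 0" using that by simp
  moreover have "(l i, w) \<notin> X" using X_sub i by auto
  moreover have "(l i, w) \<in> (\<lambda>i. (l i, l (Suc i))) ` {..<n} \<longleftrightarrow> w = l (Suc i)"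
    using i l_eq_iff by auto
  ultimately show ?thesis using M by (cases "i = 0") (auto simp: D_def)
qed

lemma out_inner: "v \<notin> L \<Longrightarrow> (v, w) \<in> D \<longleftrightarrow> (v \<in> M \<and> w = q v) \<or> (v, w) \<in> X"
  by (auto simp: D_def)

text \<open>The only leaf that can be a parent is \<open>l 0\<close>, and arcs of \<open>X\<close>
  end in \<open>R\<close>; every other leaf is therefore entered from its ring predecessor
  alone.\<close>

lemma in_leaf:
  assumes "0 < i" "i < n"
  shows "(u, l i) \<in> D \<longleftrightarrow> u = l (i - 1)"
proof
  assume "(u, l i) \<in> D"
  then consider j where "j < n" "u = l j" "l i = l (Suc j)" | "u \<in> M" "l i = q u" | "(u, l i) \<in> X"
    by (auto simp: D_def)
  then show "u = l (i - 1)"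
  proof cases
    case 1
    obtain k where k: "k < n" "l (Suc j) = l k" "k = (if Suc j = n then 0 else Suc j)"
      by (rule l_Suc_cases[OF 1(1)])
    then have "i = k" using 1(3) assms(2) l_eq_iff[of i k] by simp
    then have "i = Suc j" using k(3) assms(1) by presburger
    then show ?thesis using 1(2) by simp
  next
    case 2
    then have "q u \<in> L" using assms by (metis imageI lessThan_iff)
    then have "l i = l 0" using q_leaf 2 by metis
    then show ?thesis using assms l_eq_iff[of i 0] by simp
  next
    case 3
    then show ?thesis using X_sub R_sub assms by auto
  qed
next
  assume "u = l (i - 1)"
  then show "(u, l i) \<in> D" using assms by (auto simp: D_def intro!: image_eqI[of _ _ "i - 1"])
qed

text \<open>A pair of opposite arcs would need a ring of length at most 2, a leaf whose parent is a
  leaf, a rank \<open>h\<close> decreasing in both directions, or an arc leaving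
  \<open>R\<close>.\<close>

lemma D_asym:
  assumes "(u, v) \<in> D"
  shows "(v, u) \<notin> D"
proof
  assume vu: "(v, u) \<in> D"
  have leaf: False if "(u, v) \<in> D" "(v, u) \<in> D" "u = l i" and i: "i < n" for u v i
  proof -
    have "v = l (Suc i) \<or> (0 < i \<and> v = q (l i))" using that out_leaf by auto
    then show False
    proof
      assume v: "v = l (Suc i)"
      obtain j where j: "j < n" "l (Suc i) = l j" "j = (if Suc i = n then 0 else Suc i)"
        by (rule l_Suc_cases[OF i])
      obtain k where k: "k < n" "l (Suc j) = l k" "k = (if Suc j = n then 0 else Suc j)"
        by (rule l_Suc_cases[OF j(1)])
      have "(l j, l i) \<in> D" using that(2,3) v j(2) by simp
      then have "l i = l (Suc j) \<or> (0 < j \<and> l i = q (l j))"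
        using out_leaf[OF j(1)] by blast
      then show False
      proof
        assume "l i = l (Suc j)"
        then have "i = k" using k(1,2) i l_eq_iff[of i k] by simp
        moreover have "Suc i = n \<and> j = 0 \<or> j = Suc i" "Suc j = n \<and> k = 0 \<or> k = Suc j"
          using j(3) k(3) by presburger+
        ultimately show False using n_ge by linarith
      next
        assume *: "0 < j \<and> l i = q (l j)"
        have "l j \<in> L" using j(1) by blast
        moreover from this have "l j \<in> M" using * j(1) l_V R_sub l_eq_iff[of j 0] by auto
        moreover have "q (l j) \<in> L" using * i by (metis imageI lessThan_iff)
        ultimately show False using q_leaf by blast
      qed
    next
      assume *: "0 < i \<and> v = q (l i)"
      then have li: "l i \<in> M" using that(3) i l_V R_sub l_eq_iff[of i 0] by auto
      have "l i \<in> L" using i by blast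
      then have "v \<notin> L" using q_leaf[OF li] * by metis
      then have "(v \<in> M \<and> l i = q v) \<or> (v, l i) \<in> X" 
        using out_inner[of v "l i"] that(2,3) by simp
      then show False
      proof
        assume "v \<in> M \<and> l i = q v"
        then show False using h_q[of v] h_q[OF li] * by (metis less_asym)
      next
        assume "(v, l i) \<in> X"
        then show False using that X_sub R_sub by auto
      qed
    qed
  qed
  show False
  proof (cases "u \<in> L \<or> v \<in> L")
    case True
    then show ?thesis using leaf assms vu by blast
  next
    case False
    then have "(u \<in> M \<and> v = q u) \<or> (u, v) \<in> X" "(v \<in> M \<and> u = q v) \<or> (v, u) \<in> X"
      using assms vu out_inner by auto
    moreover have "a \<notin> R \<and> b \<in> R" if "(a, b) \<in> X" for a b
      using that X_sub R_sub by auto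
    ultimately show ?thesis
      using h_q[of u] h_q[of v] by (metis DiffD2 less_asym)
  qed
qed

text \<open>A leaf has at most its ring arc and its parent arc. Any other vertex has at most its
  parent arc and, by \<open>X_single\<close>, one arc of \<open>X\<close>.\<close>

lemma outdeg_D: "outdeg D v \<le> 2"
proof (cases "v \<in> L")
  case True
  then obtain i where "i < n" "v = l i" by blast
  then have "{w. (v, w) \<in> D} \<subseteq> {l (Suc i), q v}" using out_leaf by auto
  then have "outdeg D v \<le> card {l (Suc i), q v}" unfolding outdeg_def by (intro card_mono) auto
  also have "\<dots> \<le> 2" by (simp add: card_insert_if)
  finally show ?thesis .
next
  case False
  have "w = (THE w. (v, w) \<in> X)" if "(v, w) \<in> X" for w
    using that X_single by (metis the_equality)
  then have "{w. (v, w) \<in> D} \<subseteq> {q v, THE w. (v, w) \<in> X}"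
    using out_inner[OF False] by blast
  then have "outdeg D v \<le> card {q v, THE w. (v, w) \<in> X}" unfolding outdeg_def by (intro card_mono) auto
  also have "\<dots> \<le> 2" by (simp add: card_insert_if)
  finally show ?thesis .
qed

lemma orientation_D:
  assumes "E = {{u, v} | u v. (u, v) \<in> D}"
  shows "orientation E D"
  using D_asym assms by (auto simp: orientation_def doubleton_eq_iff)

section \<open>Flow conservation in an Eulerian subdigraph\<close>

context
  fixes S :: "('a \<times> 'a) set"
  assumes S: "eulerian_sub V D S"
begin

lemma S_D: "(u, v) \<in> S \<Longrightarrow> (u, v) \<in> D"
  using S by (auto simp: eulerian_sub_def)

lemma finite_S: "finite S"
  using S finite_D by (auto simp: eulerian_sub_def intro: finite_subset)

lemma in_iff_out: "v \<in> V \<Longrightarrow> (\<exists>u. (u, v) \<in> S) \<longleftrightarrow> (\<exists>w. (v, w) \<in> S)"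
  using S indeg_pos_iff[OF finite_S, of v] outdeg_pos_iff[OF finite_S, of v]
  by (auto simp: eulerian_sub_def)

text \<open>An Eulerian subdigraph entering \<open>v\<close> must leave it, and the only way out is
  the parent arc, which leads to a vertex of the same kind with smaller rank. The descent ends in
  \<open>R\<close>, where no arc starts.\<close>

lemma no_arc_into_sink_side: "v \<in> V \<Longrightarrow> v \<notin> A \<Longrightarrow> v \<notin> L \<Longrightarrow> (u, v) \<notin> S"
proof (induction "h v" arbitrary: u v rule: less_induct)
  case less
  have "(v, w) \<notin> S" for w
  proof
    assume vw: "(v, w) \<in> S"
    then have "(v \<in> M \<and> w = q v) \<or> (v, w) \<in> X" using S_D out_inner less.prems by blast
    then have v: "v \<in> M" "w = q v" using X_sub less.prems by auto
    have "q v \<notin> A" using q_A[OF v(1)] less.prems by blast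
    moreover from this have "q v \<notin> L" using q_leaf[OF v(1)] root_A by metis
    ultimately
    show False using less.hyps[of "q v" v] v h_q q_V vw by auto
  qed
  then show ?case using in_iff_out less.prems by blast
qed

lemma no_X: "(u, v) \<in> X \<Longrightarrow> (u, v) \<notin> S"
  using no_arc_into_sink_side[of v u] X_sub R_sub by auto

text \<open>The parent of a leaf outside \<open>A\<close> is an inner vertex outside
  \<open>A\<close>, which cannot be entered. This confines the exits from the ring to
  \<open>A\<close>.\<close>

lemma leaf_tree_arc_in_A:
  assumes "0 < i" "i < n" "(l i, q (l i)) \<in> S"
  shows "l i \<in> A"
proof (rule ccontr)
  assume "l i \<notin> A"
  have "l i \<in> M" using assms l_V R_sub l_eq_iff[of i 0] by auto
  then have "q (l i) \<in> V" "q (l i) \<notin> A" "q (l i) \<notin> L"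
    using q_V q_A q_leaf[of "l i"] assms \<open>l i \<notin> A\<close> by auto
  then show False using no_arc_into_sink_side assms by blast
qed

text \<open>The flow reaches the leaf only along the ring and then either continues along the ring
  or turns into the tree, never both.\<close>

lemma leaf_balance:
  assumes "0 < i" "i < n"
  shows "(l i, q (l i)) \<in> S \<longleftrightarrow> (l (i - 1), l i) \<in> S \<and> (l i, l (Suc i)) \<notin> S"
    and "(l i, l (Suc i)) \<in> S \<Longrightarrow> (l (i - 1), l i) \<in> S"
proof -
  have li: "l i \<in> M" using assms l_V R_sub l_eq_iff[of i 0] by auto
  then have ne: "q (l i) \<noteq> l (Suc i)" using q_leaf[of "l i"] assms l_Suc_in[of i] by auto
  have "u = l (i - 1)" if "(u, l i) \<in> S" for u
    using in_leaf[OF assms] S_D[OF that] by blast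
  then have inS: "{u. (u, l i) \<in> S} = {u. u = l (i - 1) \<and> (l (i - 1), l i) \<in> S}" by blast
  have "w = l (Suc i) \<or> w = q (l i)" if "(l i, w) \<in> S" for w
    using out_leaf[OF assms(2)] S_D[OF that] by blast
  then have outS: "{w. (l i, w) \<in> S} = {w. w = l (Suc i) \<and> (l i, l (Suc i)) \<in> S
      \<or> w = q (l i) \<and> (l i, q (l i)) \<in> S}" by blast
  have "l i \<in> V" using assms l_V by blast
  then have "card {u. (u, l i) \<in> S} = card {w. (l i, w) \<in> S}"
    using S by (simp add: eulerian_sub_def indeg_def outdeg_def)
  then have bal: "of_bool ((l (i - 1), l i) \<in> S)
    = (of_bool ((l i, l (Suc i)) \<in> S) + of_bool ((l i, q (l i)) \<in> S) :: nat)"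
    unfolding inS outS card_singleton_filter card_doubleton_filter[OF ne[symmetric]] .
  show "(l i, q (l i)) \<in> S \<longleftrightarrow> (l (i - 1), l i) \<in> S \<and> (l i, l (Suc i)) \<notin> S"
    and "(l i, l (Suc i)) \<in> S \<Longrightarrow> (l (i - 1), l i) \<in> S"
    using of_bool_eq_plusD[OF bal] by blast+
qed

end

text \<open>The trace on the ring, which serves as a code for Eulerian subdigraphs: it determines
  them and is always an initial segment.\<close>

definition ring_arcs :: "('a \<times> 'a) set \<Rightarrow> nat set" where
  "ring_arcs S = {i. i < n \<and> (l i, l (Suc i)) \<in> S}"

lemma eulerian_sub_eqI:
  assumes S: "eulerian_sub V D S" and S': "eulerian_sub V D S'"
    and eq: "ring_arcs S = ring_arcs S'"
  shows "S = S'"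
proof -
  have ring: "(l i, l (Suc i)) \<in> S \<longleftrightarrow> (l i, l (Suc i)) \<in> S'" if "i < n" for i
    using eq that by (auto simp: ring_arcs_def)
  have leaf: "(l i, q (l i)) \<in> S \<longleftrightarrow> (l i, q (l i)) \<in> S'" if "0 < i" "i < n" for i
    using leaf_balance(1)[OF S that] leaf_balance(1)[OF S' that] ring[of i] ring[of "i - 1"] that
    by auto
  have tree: "(v, q v) \<in> S \<longleftrightarrow> (v, q v) \<in> S'" if "v \<in> M" for v
    using that
  \<comment> \<open>The measure makes the induction start at the highest rank, so that children are
    treated before their parents.\<close>
  proof (induction "Max (h ` V) - h v" arbitrary: v rule: less_induct)
    case less
    show ?case
    proof (cases "v \<in> L")
      case True
      then obtain i where "i < n" "v = l i" by blast
      then show ?thesis using leaf[of i] less.prems by (cases i) auto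
    next
      case False
      have v: "v \<in> V" using less.prems by auto
      have out: "(v, q v) \<in> S'' \<longleftrightarrow> (\<exists>u\<in>M. q u = v \<and> (u, q u) \<in> S'')" if "eulerian_sub V D S''" for S''
      proof -
        have "(\<exists>w. (v, w) \<in> S'') \<longleftrightarrow> (v, q v) \<in> S''"
        proof
          assume "\<exists>w. (v, w) \<in> S''"
          then obtain w where w: "(v, w) \<in> S''" by blast
          then have "(v, w) \<in> D" "(v, w) \<notin> X" using S_D[OF that] no_X[OF that] by auto
          then show "(v, q v) \<in> S''" using out_inner[OF False] w by auto
        qed auto
        moreover have "(\<exists>u. (u, v) \<in> S'') \<longleftrightarrow> (\<exists>u\<in>M. q u = v \<and> (u, q u) \<in> S'')"
        proof
          assume "\<exists>u. (u, v) \<in> S''"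
          then obtain u where u: "(u, v) \<in> S''" by blast
          then have "(u, v) \<in> D" "(u, v) \<notin> X" using S_D[OF that] no_X[OF that] by auto
          then have "u \<in> M \<and> v = q u" using False l_Suc_in by (auto simp: D_def)
          then show "\<exists>u\<in>M. q u = v \<and> (u, q u) \<in> S''" using u by auto
        qed auto
        ultimately show ?thesis using in_iff_out[OF that v] by blast
      qed
      have "(u, q u) \<in> S \<longleftrightarrow> (u, q u) \<in> S'" if "u \<in> M" "q u = v" for u
      proof (rule less.hyps)
        have "h v < h u" "h u \<le> Max (h ` V)" using that h_q[of u] finite_V by auto
        then show "Max (h ` V) - h u < Max (h ` V) - h v" by auto
      qed (use that in auto)
      then show ?thesis using out[OF S] out[OF S'] by blast
    qed
  qed
  have "(u, v) \<in> S \<longleftrightarrow> (u, v) \<in> S'" if "(u, v) \<in> D" for u v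
    using that ring tree no_X[OF S] no_X[OF S'] by (auto simp: D_def)
  then show ?thesis using S_D[OF S] S_D[OF S'] by (auto simp: set_eq_iff)
qed

text \<open>The index of the leaf where the flow leaves the ring. The value \<open>n\<close> encodes
  the whole ring, and 0, present because \<open>l 0\<close> lies in \<open>A\<close>, encodes the
  empty subdigraph.\<close>

definition exits :: "nat set" where
  "exits = insert n {j. j < n \<and> l j \<in> A}"

text \<open>A used ring arc forces its predecessor to be used, back to \<open>l 0\<close>. Where an
  initial segment stops strictly inside the ring, the flow turns into the tree, which is possible
  only in \<open>A\<close>.\<close>

lemma ring_arcs_initial:
  assumes S: "eulerian_sub V D S"
  shows "\<exists>j\<in>exits. ring_arcs S = {..<j}"
proof -
  define j where "j = (LEAST j. j = n \<or> (l j, l (Suc j)) \<notin> S)"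
  have j: "j = n \<or> (l j, l (Suc j)) \<notin> S" unfolding j_def by (rule LeastI[of _ n]) simp
  have j_le: "j \<le> n" unfolding j_def by (rule Least_le) simp
  have below: "(l i, l (Suc i)) \<in> S" if "i < j" for i
    using not_less_Least[of i "\<lambda>j. j = n \<or> (l j, l (Suc j)) \<notin> S"] that j_def by auto
  have above: "(l i, l (Suc i)) \<notin> S" if "j \<le> i" "i < n" for i
    using that
  proof (induction i rule: dec_induct)
    case base
    then show ?case using j by auto
  next
    case (step i)
    then show ?case using leaf_balance(2)[OF S, of "Suc i"] by auto
  qed
  have "ring_arcs S = {..<j}"
    using below above j_le by (auto simp: ring_arcs_def) (meson not_le)
  moreover have "j \<in> exits"
  proof -
    consider "j = n" | "j = 0" | "0 < j" "j < n" using j_le by linarith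
    then show ?thesis
    proof cases
      case 3
      then have "(l (j - 1), l j) \<in> S" "(l j, l (Suc j)) \<notin> S" using below[of "j - 1"] j by auto
      then have "(l j, q (l j)) \<in> S" using leaf_balance(1)[OF S] 3 by blast
      then show ?thesis using leaf_tree_arc_in_A[OF S] 3 by (auto simp: exits_def)
    qed (use root_A n_ge in \<open>auto simp: exits_def\<close>)
  qed
  ultimately show ?thesis by blast
qed

text \<open>Parents stay in \<open>A\<close>, which is disjoint from \<open>R\<close>, and ranks
  decrease, so the path can stop only at \<open>l 0\<close>. It is the return path of the cycles
  constructed next.\<close>

lemma funpow_q_reaches_root:
  assumes "v \<in> A"
  shows "\<exists>m. (q ^^ m) v = l 0 \<and> (\<forall>k<m. (q ^^ k) v \<in> A \<and> (q ^^ k) v \<in> M)"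
  using assms
proof (induction "h v" arbitrary: v rule: less_induct)
  case less
  show ?case
  proof (cases "v = l 0")
    case True
    then show ?thesis by (intro exI[of _ 0]) auto
  next
    case False
    then have v: "v \<in> M" using less.prems A_V R_sub by auto
    then obtain m where m: "(q ^^ m) (q v) = l 0" "\<forall>k<m. (q ^^ k) (q v) \<in> A \<and> (q ^^ k) (q v) \<in> M"
      using less.hyps[of "q v"] h_q q_A less.prems by blast
    have "(q ^^ k) v \<in> A \<and> (q ^^ k) v \<in> M" if "k < Suc m" for k
      using that m(2) v less.prems by (cases k) (auto simp: funpow_Suc_right simp del: funpow.simps)
    then show ?thesis
      using m by (intro exI[of _ "Suc m"]) (auto simp: funpow_Suc_right simp del: funpow.simps)
  qed
qed

text \<open>The cycle follows the ring from \<open>l 0\<close> to \<open>l j\<close> and returns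
  through the tree; the extreme exits give the whole ring and the empty set.\<close>

lemma eulerian_sub_of_exit:
  assumes "j \<in> exits"
  shows "\<exists>S. eulerian_sub V D S \<and> ring_arcs S = {..<j}"
proof -
  consider "j = n" | "j = 0" | "0 < j" "j < n" "l j \<in> A" using assms by (auto simp: exits_def)
  then show ?thesis
  proof cases
    case 1
    define f where "f = (\<lambda>v. l (Suc (THE i. i < n \<and> v = l i)))"
    have f: "f (l i) = l (Suc i)" if "i < n" for i
    proof -
      have "(THE k. k < n \<and> l i = l k) = i" using that by (intro the_equality) (auto simp: l_eq_iff)
      then show ?thesis by (simp add: f_def)
    qed
    have "f ` L = L"
    proof
      show "f ` L \<subseteq> L" using f l_Suc_in by auto
      show "L \<subseteq> f ` L"
      proof
        fix v assume "v \<in> L"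
        then obtain i where i: "i < n" "v = l i" by blast
        \<comment> \<open>Since \<open>l n = l 0\<close>, the predecessor of \<open>l 0\<close> is
          \<open>l (n - 1)\<close>.\<close>
        then have "v = f (l (if i = 0 then n - 1 else i - 1))"
          using f[of "if i = 0 then n - 1 else i - 1"] l_n n_ge by auto
        moreover have "(if i = 0 then n - 1 else i - 1) < n" using i by auto
        ultimately show "v \<in> f ` L" by blast
      qed
    qed
    moreover have "(\<lambda>v. (v, f v)) ` L \<subseteq> D" using f by (auto simp: D_def)
    ultimately have "eulerian_sub V D ((\<lambda>v. (v, f v)) ` L)"
      by (intro eulerian_sub_of_permutation) auto
    moreover have "ring_arcs ((\<lambda>v. (v, f v)) ` L) = {..<j}"
      using 1 f by (auto simp: ring_arcs_def image_iff)
    ultimately show ?thesis by blast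
  next
    case 2
    have "eulerian_sub V D {}" by (auto simp: eulerian_sub_def indeg_def outdeg_def)
    moreover have "ring_arcs {} = {..<j}" using 2 by (auto simp: ring_arcs_def)
    ultimately show ?thesis by blast
  next
    case 3
    obtain m where m: "(q ^^ m) (l j) = l 0" "\<forall>k<m. (q ^^ k) (l j) \<in> A \<and> (q ^^ k) (l j) \<in> M"
      using funpow_q_reaches_root[OF 3(3)] by blast
    have m0: "0 < m"
    proof (rule ccontr)
      assume "\<not> 0 < m"
      then show False using m(1) 3 l_eq_iff[of j 0] by simp
    qed
    \<comment> \<open>\<open>P\<close> is the return path from \<open>l j\<close> without its end
      \<open>l 0\<close>, and \<open>Q\<close> is the ring part without \<open>l j\<close>. They
      partition the vertices of the cycle, and \<open>f\<close> is its successor map.\<close>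
    define P where "P = (\<lambda>k. (q ^^ k) (l j)) ` {..<m}"
    define Q where "Q = l ` {..<j}"
    define f where "f = (\<lambda>v. if v \<in> Q then l (Suc (THE i. i < n \<and> v = l i)) else q v)"
    have PL: "(q ^^ k) (l j) \<notin> L" if k0: "0 < k" and "k < m" for k
    proof
      assume k: "(q ^^ k) (l j) \<in> L"
      obtain k' where k': "k = Suc k'" using gr0_implies_Suc[OF k0] by blast
      have "(q ^^ k') (l j) \<in> M" using m(2) that k' by auto
      then have "(q ^^ k) (l j) = l 0" using q_leaf[of "(q ^^ k') (l j)"] k k' by auto
      moreover have "(q ^^ k) (l j) \<in> M" using m(2) that by blast
      ultimately show False by auto
    qed
    have lP: "l i \<in> P \<longleftrightarrow> i = j" if "i < n" for i
    proof
      assume "l i \<in> P"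
      then obtain k where k: "k < m" "l i = (q ^^ k) (l j)" by (auto simp: P_def)
      moreover have "l i \<in> L" using that by blast
      ultimately have "k = 0" using PL[of k] by force
      then show "i = j" using k that 3 l_eq_iff[of i j] by simp
    next
      assume "i = j" then show "l i \<in> P" using m0 by (auto simp: P_def intro!: image_eqI[of _ _ 0])
    qed
    have disj: "P \<inter> Q = {}" using lP 3 by (auto simp: Q_def)
    have fQ: "f (l i) = l (Suc i)" if "i < j" for i
    proof -
      have "(THE k. k < n \<and> l i = l k) = i"
        using that 3 by (intro the_equality) (auto simp: l_eq_iff)
      then show ?thesis using that by (simp add: f_def Q_def)
    qed
    have fP: "f v = q v" if "v \<in> P" for v using that disj by (auto simp: f_def)
    have ljP: "l j \<in> P" using lP 3 by auto
    have l0Q: "l 0 \<in> Q" using 3 by (auto simp: Q_def)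
    have fPow: "f ((q ^^ k) (l j)) = (q ^^ Suc k) (l j)" if "k < m" for k
      using fP[of "(q ^^ k) (l j)"] that by (auto simp: P_def)
    have powin: "(q ^^ k) (l j) \<in> P \<union> Q" if "k \<le> m" for k
      using that m(1) l0Q by (cases "k = m") (auto simp: P_def)
    have lin: "l i \<in> P \<union> Q" if "i \<le> j" for i
      using that ljP by (cases "i = j") (auto simp: Q_def)
    \<comment> \<open>Only the seams need care: \<open>l (j - 1)\<close> leads from \<open>Q\<close>
      to \<open>l j\<close> in \<open>P\<close>, and the last vertex of \<open>P\<close> leads back
      to \<open>l 0\<close> in \<open>Q\<close>.\<close>
    have img: "f ` (P \<union> Q) = P \<union> Q"
    proof
      show "f ` (P \<union> Q) \<subseteq> P \<union> Q"
      proof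
        fix w assume "w \<in> f ` (P \<union> Q)"
        then consider k where "k < m" "w = f ((q ^^ k) (l j))" | i where "i < j" "w = f (l i)"
          by (auto simp: P_def Q_def)
        then show "w \<in> P \<union> Q"
        proof cases
          case (1 k)
          then show ?thesis using fPow[of k] powin[of "Suc k"] by auto
        next
          case (2 i)
          then show ?thesis using fQ[of i] lin[of "Suc i"] by auto
        qed
      qed
      show "P \<union> Q \<subseteq> f ` (P \<union> Q)"
      proof
        fix w assume "w \<in> P \<union> Q"
        then consider k where "k < m" "w = (q ^^ k) (l j)" | i where "i < j" "w = l i"
          by (auto simp: P_def Q_def)
        then show "w \<in> f ` (P \<union> Q)"
        proof cases
          case (1 k)
          show ?thesis
          proof (cases k)
            case 0
            then have "w = f (l (j - 1))" using 1 fQ[of "j - 1"] 3 by auto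
            moreover have "l (j - 1) \<in> P \<union> Q" by (rule lin) simp
            ultimately show ?thesis by (rule image_eqI)
          next
            case (Suc k')
            then have "w = f ((q ^^ k') (l j))" using 1 fPow[of k'] by auto
            moreover have "(q ^^ k') (l j) \<in> P \<union> Q" using 1 Suc by (intro powin) simp
            ultimately show ?thesis by (rule image_eqI)
          qed
        next
          case (2 i)
          show ?thesis
          proof (cases i)
            case 0
            then have "w = f ((q ^^ (m - 1)) (l j))" using 2 fPow[of "m - 1"] m(1) m0 by auto
            moreover have "(q ^^ (m - 1)) (l j) \<in> P \<union> Q" by (intro powin) simp
            ultimately show ?thesis by (rule image_eqI)
          next
            case (Suc i')
            then have "w = f (l i')" using 2 fQ[of i'] by auto
            moreover have "l i' \<in> P \<union> Q" using 2 Suc by (intro lin) simp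
            ultimately show ?thesis by (rule image_eqI)
          qed
        qed
      qed
    qed
    have PM: "P \<subseteq> M" using m(2) by (auto simp: P_def)
    let ?S = "(\<lambda>v. (v, f v)) ` (P \<union> Q)"
    have "?S \<subseteq> D"
    proof
      fix d assume "d \<in> ?S"
      then consider v where "v \<in> P" "d = (v, q v)" | i where "i < j" "d = (l i, l (Suc i))"
        using fP fQ by (auto simp: Q_def)
      then show "d \<in> D"
        using PM 3 by cases (auto simp: D_def)
    qed
    then have "eulerian_sub V D ?S"
      using img by (intro eulerian_sub_of_permutation) (auto simp: P_def Q_def)
    moreover have "ring_arcs ?S = {..<j}"
    proof (intro equalityI subsetI)
      fix i assume "i \<in> ring_arcs ?S"
      then have i: "i < n" "l i \<in> P \<union> Q" "f (l i) = l (Suc i)" by (auto simp: ring_arcs_def)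
      show "i \<in> {..<j}"
      proof (cases "l i \<in> Q")
        case True
        then show ?thesis using i 3 l_eq_iff by (auto simp: Q_def)
      next
        \<comment> \<open>At \<open>l j\<close> the cycle uses the parent arc, which is not a ring
          arc because the parent of a leaf is not a leaf here.\<close>
        case False
        then have "i = j" using lP i by auto
        then have "q (l j) = l (Suc j)" using i fP ljP by auto
        moreover have "l j \<in> M" using PM ljP by auto
        ultimately show ?thesis using q_leaf[of "l j"] l_Suc_in[of j] 3 by auto
      qed
    next
      fix i assume "i \<in> {..<j}"
      then show "i \<in> ring_arcs ?S"
        using fQ 3 by (auto simp: ring_arcs_def Q_def image_iff)
    qed
    ultimately show ?thesis by blast
  qed
qed

text \<open>The traces biject with \<open>exits\<close>; the successor accounts for the exit
  \<open>n\<close>.\<close>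

lemma card_eulerian_subs: "card {S. eulerian_sub V D S} = Suc (card (L \<inter> A))"
proof -
  have "ring_arcs ` {S. eulerian_sub V D S} = lessThan ` exits"
    using ring_arcs_initial eulerian_sub_of_exit by (auto simp: image_iff) metis
  moreover have "inj_on ring_arcs {S. eulerian_sub V D S}"
    by (rule inj_onI, rule eulerian_sub_eqI) auto
  ultimately have "card {S. eulerian_sub V D S} = card (lessThan ` exits)"
    by (metis card_image)
  also have "\<dots> = card exits" by (rule card_image) (auto simp: inj_on_def)
  also have "\<dots> = Suc (card {j. j < n \<and> l j \<in> A})" by (simp add: exits_def)
  also have "card {j. j < n \<and> l j \<in> A} = card (l ` {j. j < n \<and> l j \<in> A})"
    by (rule card_image[symmetric]) (auto simp: inj_on_def l_eq_iff)
  also have "l ` {j. j < n \<and> l j \<in> A} = L \<inter> A" by auto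
  finally show ?thesis .
qed

lemma even_ne_odd_eulerian_D:
  assumes "even (card (L \<inter> A))"
  shows "even_eulerian V D \<noteq> odd_eulerian V D"
proof (rule even_ne_odd_eulerian[OF finite_D])
  show "odd (card {S. eulerian_sub V D S})"
    unfolding card_eulerian_subs using assms by (simp only: even_Suc not_not)
qed

end
section \<open>Rooting and cutting trees\<close>

abbreviation adj :: "'a set set \<Rightarrow> ('a \<times> 'a) set" where
  "adj F \<equiv> {(x, y). {x, y} \<in> F}"

lemma adj_rtrancl_sym:
  assumes "(x, y) \<in> (adj F)\<^sup>*"
  shows "(y, x) \<in> (adj F)\<^sup>*"
proof -
  have "sym (adj F)" by (auto simp: sym_def insert_commute)
  then show ?thesis using symD[OF sym_rtrancl assms] by blast
qed

text \<open>The rank is the distance from \<open>r\<close> in \<open>F\<close>, and the parent is a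
  neighbour one step closer. Vertices outside the component of \<open>r\<close> are left
  unconstrained.\<close>

lemma rooting:
  obtains q :: "'a \<Rightarrow> 'a" and h :: "'a \<Rightarrow> nat" where
    "\<And>v. (r, v) \<in> (adj F)\<^sup>* \<Longrightarrow> v \<noteq> r \<Longrightarrow>
       {v, q v} \<in> F \<and> h (q v) < h v \<and> (r, q v) \<in> (adj F)\<^sup>*"
proof -
  define h where "h = (\<lambda>v. LEAST k. (r, v) \<in> adj F ^^ k)"
  have "\<exists>u. {v, u} \<in> F \<and> h u < h v \<and> (r, u) \<in> (adj F)\<^sup>*" if rv: "(r, v) \<in> (adj F)\<^sup>*" "v \<noteq> r" for v
  proof -
    have hv: "(r, v) \<in> adj F ^^ h v"
      unfolding h_def by (rule LeastI_ex) (rule rtrancl_imp_relpow[OF rv(1)])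
    then obtain k where k: "h v = Suc k" using rv(2) by (cases "h v") auto
    then obtain u where u: "(r, u) \<in> adj F ^^ k" "{u, v} \<in> F" using hv by auto
    then have "h u \<le> k" unfolding h_def by (intro Least_le)
    moreover have "(r, u) \<in> (adj F)\<^sup>*" using u(1) by (rule relpow_imp_rtrancl)
    ultimately show ?thesis using u(2) k by (intro exI[of _ u]) (simp add: insert_commute)
  qed
  then have "\<forall>v. \<exists>u. (r, v) \<in> (adj F)\<^sup>* \<and> v \<noteq> r \<longrightarrow>
      {v, u} \<in> F \<and> h u < h v \<and> (r, u) \<in> (adj F)\<^sup>*"
    by blast
  then have "\<exists>q. \<forall>v. (r, v) \<in> (adj F)\<^sup>* \<and> v \<noteq> r \<longrightarrow>
      {v, q v} \<in> F \<and> h (q v) < h v \<and> (r, q v) \<in> (adj F)\<^sup>*"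
    by (rule choice)
  then show ?thesis using that by blast
qed

text \<open>Two vertices with the same parent edge would be parents of each other, against the
  ranks. Hence parent edges can be counted by their children.\<close>

lemma inj_on_parent_edges:
  fixes h :: "'a \<Rightarrow> nat"
  assumes "\<And>v. v \<in> W \<Longrightarrow> h (q v) < h v"
  shows "inj_on (\<lambda>v. {v, q v}) W"
proof (rule inj_onI)
  fix v w assume vw: "v \<in> W" "w \<in> W" "{v, q v} = {w, q w}"
  show "v = w"
  proof (rule ccontr)
    assume "v \<noteq> w"
    then have "v = q w" "w = q v" using vw(3) by (auto simp: doubleton_eq_iff)
    then show False using assms[OF vw(1)] assms[OF vw(2)] by simp
  qed
qed

lemma finite_edges:
  assumes "simple_graph V F"
  shows "finite F"
  using assms by (intro finite_subset[of F "Pow V"]) (auto simp: simple_graph_def)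

definition side :: "'a set set \<Rightarrow> 'a \<Rightarrow> 'a \<Rightarrow> 'a set" where
  "side T a b = {z. (a, z) \<in> (adj (T - {{a, b}}))\<^sup>*}"

lemma side_self: "a \<in> side T a b"
  by (simp add: side_def)

lemma side_step:
  assumes "u \<in> side T a b" "{u, v} \<in> T" "{u, v} \<noteq> {a, b}"
  shows "v \<in> side T a b"
proof -
  have "(u, v) \<in> adj (T - {{a, b}})" using assms by simp
  then show ?thesis using assms(1) unfolding side_def by (auto intro: rtrancl_into_rtrancl)
qed

locale tree =
  fixes V :: "'a set" and T :: "'a set set"
  assumes is_tree: "is_tree V T"
begin

lemma finite_V: "finite V" and card_T: "card T + 1 = card V"
  using is_tree by (auto simp: is_tree_def simple_graph_def)

lemma finite_T: "finite T"
  using is_tree finite_edges by (auto simp: is_tree_def)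

lemma edge_V: "{u, v} \<in> T \<Longrightarrow> u \<in> V \<and> v \<in> V \<and> u \<noteq> v"
  using is_tree by (force simp: is_tree_def simple_graph_def doubleton_eq_iff)

lemma reach: "u \<in> V \<Longrightarrow> v \<in> V \<Longrightarrow> (u, v) \<in> (adj T)\<^sup>*"
  using is_tree by (auto simp: is_tree_def connected_graph_def)

lemma finite_nbrs: "finite (nbrs T v)"
  using edge_V finite_V by (auto simp: nbrs_def intro: finite_subset[of _ V])

text \<open>The parent edges of the vertices other than \<open>r\<close> are
  \<open>card V - 1\<close> distinct edges of \<open>T\<close>, which is all of them.\<close>

lemma tree_rooting:
  assumes "r \<in> V"
  obtains q :: "'a \<Rightarrow> 'a" and h :: "'a \<Rightarrow> nat" where
    "\<And>v. v \<in> V - {r} \<Longrightarrow> q v \<in> V" "\<And>v. v \<in> V - {r} \<Longrightarrow> h (q v) < h v"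
    "T = (\<lambda>v. {v, q v}) ` (V - {r})"
proof -
  obtain q :: "'a \<Rightarrow> 'a" and h :: "'a \<Rightarrow> nat" where qh:
    "\<And>v. (r, v) \<in> (adj T)\<^sup>* \<Longrightarrow> v \<noteq> r \<Longrightarrow> {v, q v} \<in> T \<and> h (q v) < h v \<and> (r, q v) \<in> (adj T)\<^sup>*"
    using rooting[of r T] by blast
  have q: "{v, q v} \<in> T" "h (q v) < h v" if "v \<in> V - {r}" for v
    using qh[of v] reach[OF assms, of v] that by auto
  have "(\<lambda>v. {v, q v}) ` (V - {r}) = T"
  proof (rule card_subset_eq[OF finite_T])
    show "(\<lambda>v. {v, q v}) ` (V - {r}) \<subseteq> T" using q by auto
    have "card ((\<lambda>v. {v, q v}) ` (V - {r})) = card (V - {r})"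
      using q(2) by (intro card_image inj_on_parent_edges[where h = h]) auto
    then show "card ((\<lambda>v. {v, q v}) ` (V - {r})) = card T"
      using card_T assms finite_V by simp
  qed
  moreover have "q v \<in> V" if "v \<in> V - {r}" for v using q(1)[OF that] edge_V by blast
  ultimately show ?thesis using q(2) that by metis
qed

context
  fixes a b :: 'a
  assumes ab: "{a, b} \<in> T"
begin

lemma side_Un: "side T a b \<union> side T b a = V"
proof
  have "z \<in> V" if "(u, z) \<in> (adj (T - {{a, b}}))\<^sup>*" "u \<in> V" for u z
    using that by (induction rule: rtrancl_induct) (use edge_V in auto)
  then show "side T a b \<union> side T b a \<subseteq> V"
    using edge_V[OF ab] by (auto simp: side_def insert_commute)
  show "V \<subseteq> side T a b \<union> side T b a"
  proof
    fix z assume "z \<in> V"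
    then have "(a, z) \<in> (adj T)\<^sup>*" using reach edge_V[OF ab] by blast
    then show "z \<in> side T a b \<union> side T b a"
    proof (induction rule: rtrancl_induct)
      case base
      then show ?case using side_self by auto
    next
      case (step y z)
      show ?case
      proof (cases "{y, z} = {a, b}")
        case True
        then show ?thesis using side_self[of a T b] side_self[of b T a] by (auto simp: doubleton_eq_iff)
      next
        case False
        then show ?thesis
          using step side_step[of y T a b z] side_step[of y T b a z] by (auto simp: insert_commute)
      qed
    qed
  qed
qed

lemma side_swap: "side T b a = {z. (b, z) \<in> (adj (T - {{a, b}}))\<^sup>*}"
  by (simp only: side_def insert_commute[of b a "{}"])

text \<open>A common vertex would leave the graph connected after deleting the edge. Rooting it
  would then give \<open>card V - 1\<close> distinct edges, one more than remain.\<close>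

lemma side_Int: "side T a b \<inter> side T b a = {}"
proof (rule ccontr)
  let ?F = "T - {{a, b}}"
  assume "side T a b \<inter> side T b a \<noteq> {}"
  then obtain z where "(a, z) \<in> (adj ?F)\<^sup>*" "(b, z) \<in> (adj ?F)\<^sup>*"
    unfolding side_swap by (auto simp only: side_def)
  then have "(a, b) \<in> (adj ?F)\<^sup>*" by (rule rtrancl_trans[OF _ adj_rtrancl_sym])
  then have "side T b a \<subseteq> side T a b"
    unfolding side_swap unfolding side_def by (blast intro: rtrancl_trans)
  then have V: "(a, v) \<in> (adj ?F)\<^sup>*" if "v \<in> V" for v
    using that side_Un unfolding side_def[of T a b] by blast
  obtain q :: "'a \<Rightarrow> 'a" and h :: "'a \<Rightarrow> nat" where qh:
    "\<And>v. (a, v) \<in> (adj ?F)\<^sup>* \<Longrightarrow> v \<noteq> a \<Longrightarrow> {v, q v} \<in> ?F \<and> h (q v) < h v \<and> (a, q v) \<in> (adj ?F)\<^sup>*"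
    using rooting[of a ?F] by blast
  have "card (V - {a}) \<le> card ?F"
  proof (rule card_inj_on_le)
    show "inj_on (\<lambda>v. {v, q v}) (V - {a})"
      using qh V by (intro inj_on_parent_edges[where h = h]) auto
    show "(\<lambda>v. {v, q v}) ` (V - {a}) \<subseteq> ?F" using qh V by blast
    show "finite ?F" using finite_T by simp
  qed
  moreover have "card ?F < card T" using ab finite_T by (rule card_Diff1_less[rotated])
  moreover have "card (V - {a}) = card V - 1" using edge_V[OF ab] finite_V by simp
  ultimately show False using card_T by simp
qed

text \<open>The component of \<open>a\<close> is rooted at \<open>x\<close>, the other at
  \<open>b\<close>, and the two parent maps are glued. Their \<open>card V - 2\<close> parent edges
  exhaust the tree except for the cut edge.\<close>

lemma cut_rooting:
  assumes x: "x \<in> side T a b"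
  obtains q :: "'a \<Rightarrow> 'a" and h :: "'a \<Rightarrow> nat" where
    "\<And>v. v \<in> V - {x} - {b} \<Longrightarrow> q v \<in> V" "\<And>v. v \<in> V - {x} - {b} \<Longrightarrow> h (q v) < h v"
    "\<And>v. v \<in> V - {x} - {b} \<Longrightarrow> q v \<in> side T a b \<longleftrightarrow> v \<in> side T a b"
    "T = insert {a, b} ((\<lambda>v. {v, q v}) ` (V - {x} - {b}))"
proof -
  let ?F = "T - {{a, b}}" and ?A = "side T a b" and ?B = "side T b a" and ?M = "V - {x} - {b}"
  have F: "T - {{b, a}} = ?F" by (simp add: insert_commute)
  have ax: "(a, x) \<in> (adj ?F)\<^sup>*" using x by (simp add: side_def)
  have A: "v \<in> ?A \<longleftrightarrow> (x, v) \<in> (adj ?F)\<^sup>*" for v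
    using ax adj_rtrancl_sym[OF ax] by (auto simp: side_def intro: rtrancl_trans)
  have B: "v \<in> ?B \<longleftrightarrow> (b, v) \<in> (adj ?F)\<^sup>*" for v
    by (simp add: side_def F)
  obtain q1 :: "'a \<Rightarrow> 'a" and h1 :: "'a \<Rightarrow> nat" where 1:
    "\<And>v. (x, v) \<in> (adj ?F)\<^sup>* \<Longrightarrow> v \<noteq> x \<Longrightarrow> {v, q1 v} \<in> ?F \<and> h1 (q1 v) < h1 v \<and> (x, q1 v) \<in> (adj ?F)\<^sup>*"
    using rooting[of x ?F] by blast
  obtain q2 :: "'a \<Rightarrow> 'a" and h2 :: "'a \<Rightarrow> nat" where 2:
    "\<And>v. (b, v) \<in> (adj ?F)\<^sup>* \<Longrightarrow> v \<noteq> b \<Longrightarrow> {v, q2 v} \<in> ?F \<and> h2 (q2 v) < h2 v \<and> (b, q2 v) \<in> (adj ?F)\<^sup>*"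
    using rooting[of b ?F] by blast
  define q where "q = (\<lambda>v. if v \<in> ?A then q1 v else q2 v)"
  define h where "h = (\<lambda>v. if v \<in> ?A then h1 v else h2 v)"
  have q: "{v, q v} \<in> ?F \<and> h (q v) < h v \<and> (q v \<in> ?A \<longleftrightarrow> v \<in> ?A)" if v: "v \<in> ?M" for v
  proof (cases "v \<in> ?A")
    case True
    then have *: "{v, q1 v} \<in> ?F \<and> h1 (q1 v) < h1 v \<and> (x, q1 v) \<in> (adj ?F)\<^sup>*"
      using 1[of v] A[of v] v by blast
    then have "q1 v \<in> ?A" using A by blast
    then show ?thesis using True * by (simp add: q_def h_def)
  next
    case False
    then have "v \<in> ?B" using v side_Un by blast
    then have *: "{v, q2 v} \<in> ?F \<and> h2 (q2 v) < h2 v \<and> (b, q2 v) \<in> (adj ?F)\<^sup>*"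
      using 2[of v] B[of v] v by blast
    then have "q2 v \<in> ?B" using B by blast
    then have "q2 v \<notin> ?A" using side_Int by blast
    then show ?thesis using False * by (simp add: q_def h_def)
  qed
  have xb: "x \<noteq> b" using x side_self[of b T a] side_Int by blast
  have "(\<lambda>v. {v, q v}) ` ?M = ?F"
  proof (rule card_subset_eq)
    show "finite ?F" using finite_T by simp
    show "(\<lambda>v. {v, q v}) ` ?M \<subseteq> ?F" using q by blast
    have "card ((\<lambda>v. {v, q v}) ` ?M) = card ?M"
      using q by (intro card_image inj_on_parent_edges[where h = h]) blast
    also have "card ?M = card V - 2"
      using xb x side_Un edge_V[OF ab] finite_V by (subst card_Diff_singleton) auto
    also have "\<dots> = card ?F" using card_T ab finite_T by (subst card_Diff_singleton) auto
    finally show "card ((\<lambda>v. {v, q v}) ` ?M) = card ?F" .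
  qed
  then have T: "T = insert {a, b} ((\<lambda>v. {v, q v}) ` ?M)" using ab by blast
  have qV: "q v \<in> V" if "v \<in> ?M" for v using q[OF that] edge_V by blast
  show ?thesis
    by (rule that[of q h, OF qV _ _ T]) (use q in blast)+
qed

end

section \<open>Leaves and degrees in trees\<close>

lemma leaf_nbr_unique:
  assumes "v \<in> leaves V T" "{u, v} \<in> T" "{w, v} \<in> T"
  shows "u = w"
proof -
  obtain z where "nbrs T v = {z}"
    using assms(1) by (auto simp: leaves_def deg_def card_1_singleton_iff)
  then have "u \<in> {z}" "w \<in> {z}" using assms(2,3) by (auto simp: nbrs_def)
  then show ?thesis by simp
qed

lemma leaf_nbr_ex:
  assumes "v \<in> leaves V T"
  shows "\<exists>u. {v, u} \<in> T"
proof -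
  obtain z where "nbrs T v = {z}"
    using assms(1) by (auto simp: leaves_def deg_def card_1_singleton_iff)
  then have "{z, v} \<in> T" by (auto simp: nbrs_def)
  then show ?thesis by (auto simp: insert_commute)
qed

text \<open>Handshaking: \<open>adj T\<close> splits into arcs from child to parent and their
  disjoint reversals, and outdegree in \<open>adj T\<close> is degree in \<open>T\<close>.\<close>

lemma sum_deg: "(\<Sum>v\<in>V. deg T v) = 2 * card T"
proof -
  obtain r where r: "r \<in> V" using is_tree by (auto simp: is_tree_def)
  obtain q :: "'a \<Rightarrow> 'a" and h :: "'a \<Rightarrow> nat" where
    qV: "\<And>v. v \<in> V - {r} \<Longrightarrow> q v \<in> V" and h: "\<And>v. v \<in> V - {r} \<Longrightarrow> h (q v) < h v"
    and T: "T = (\<lambda>v. {v, q v}) ` (V - {r})"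
    using tree_rooting[OF r] by blast
  let ?D = "(\<lambda>v. (v, q v)) ` (V - {r})" and ?D' = "(\<lambda>v. (q v, v)) ` (V - {r})"
  have adj: "adj T = ?D \<union> ?D'"
    unfolding T by (auto simp: doubleton_eq_iff image_iff)
  have "?D \<inter> ?D' = {}"
  proof (rule ccontr)
    assume "?D \<inter> ?D' \<noteq> {}"
    then obtain v w where "v \<in> V - {r}" "w \<in> V - {r}" "v = q w" "q v = w" by auto
    then show False using h[of v] h[of w] by auto
  qed
  then have "card (adj T) = card ?D + card ?D'"
    unfolding adj using finite_V by (intro card_Un_disjoint) auto
  also have "card ?D = card (V - {r})" by (rule card_image) (auto simp: inj_on_def)
  also have "card ?D' = card (V - {r})" by (rule card_image) (auto simp: inj_on_def)
  also have "card (V - {r}) = card T" using card_T r finite_V by simp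
  finally have "card (adj T) = 2 * card T" by simp
  moreover have "(\<Sum>v\<in>V. outdeg (adj T) v) = card (adj T)"
    using edge_V by (intro sum_outdeg finite_V) auto
  moreover have "outdeg (adj T) v = deg T v" for v
    by (simp add: outdeg_def deg_def nbrs_def insert_commute)
  ultimately show ?thesis by simp
qed

end

locale halin_tree = tree +
  assumes deg_ne_2: "\<And>v. v \<in> V \<Longrightarrow> deg T v \<noteq> 2"
    and branching: "\<exists>v\<in>V. 3 \<le> deg T v"
begin

abbreviation "L \<equiv> leaves V T"

lemma inner_deg:
  assumes "v \<in> V" "v \<notin> L"
  shows "3 \<le> deg T v"
proof -
  obtain c where c: "c \<in> V" "3 \<le> deg T c" using branching by blast
  have "nbrs T v \<noteq> {}"
  proof (cases "v = c")
    case True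
    then show ?thesis using c by (auto simp: deg_def)
  next
    case False
    obtain u where "(v, u) \<in> adj T"
      using reach[OF assms(1) c(1)] False by (auto elim: converse_rtranclE)
    then show ?thesis by (auto simp: nbrs_def insert_commute)
  qed
  then have "deg T v \<noteq> 0" using finite_nbrs by (simp add: deg_def)
  moreover have "deg T v \<noteq> 1" using assms by (auto simp: leaves_def)
  ultimately show ?thesis using deg_ne_2[OF assms(1)] by simp
qed

text \<open>Two adjacent leaves would form a whole component, leaving no place for the branching
  vertex.\<close>

lemma leaves_not_adjacent:
  assumes "u \<in> L" "{u, v} \<in> T"
  shows "v \<notin> L"
proof
  assume v: "v \<in> L"
  have "z \<in> {u, v}" if "(u, z) \<in> (adj T)\<^sup>*" for z
    using that
  proof (induction rule: rtrancl_induct)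
    case (step y z)
    then have "{z, y} \<in> T" by (simp add: insert_commute)
    then show ?case
      using step.IH leaf_nbr_unique[OF assms(1), of v z] leaf_nbr_unique[OF v, of u z] assms(2)
      by (auto simp: insert_commute)
  qed simp
  moreover obtain c where c: "c \<in> V" "3 \<le> deg T c" using branching by blast
  moreover have "u \<in> V" using assms by (simp add: leaves_def)
  ultimately have "c \<in> {u, v}" using reach by blast
  then show False using c assms(1) v by (auto simp: leaves_def)
qed

text \<open>With I inner vertices, the degree sum 2(card V - 1) is at least card L + 3I, so card L
  is at least I + 2. The branching vertex gives card V at least 4, and together these force three
  leaves.\<close>

lemma leaf_count: "3 \<le> card L"
proof -
  obtain c where c: "c \<in> V" "3 \<le> deg T c" using branching by blast
  have "deg T c < card V"
    unfolding deg_def using edge_V c finite_V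
    by (intro psubset_card_mono) (auto simp: nbrs_def)
  have fin: "finite L" "L \<subseteq> V" using finite_V by (auto simp: leaves_def)
  have "(\<Sum>v\<in>V. if v \<in> L then 1 else 3) \<le> (\<Sum>v\<in>V. deg T v)"
    using inner_deg by (intro sum_mono) (auto simp: leaves_def)
  moreover have "(\<Sum>v\<in>V. if v \<in> L then 1 else 3 :: nat) = card L + 3 * card (V - L)"
    using sum.If_cases[OF finite_V, of "\<lambda>v. v \<in> L" "\<lambda>_. 1" "\<lambda>_. 3 :: nat"] fin(2)
    by (simp add: Int_absorb1 Diff_eq)
  moreover have "card V = card L + card (V - L)"
    using fin finite_V by (metis card_Diff_subset card_mono le_add_diff_inverse)
  ultimately show ?thesis
    using sum_deg card_T c(2) \<open>deg T c < card V\<close> by linarith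
qed

text \<open>A leaf in \<open>M\<close> that is also a parent would have both a child and its own
  parent as neighbours. A general domain \<open>M\<close> serves the rooted tree and the cut tree
  alike.\<close>

lemma parent_is_leaf:
  fixes h :: "'a \<Rightarrow> nat"
  assumes "\<And>v. v \<in> M \<Longrightarrow> {v, q v} \<in> T" "\<And>v. v \<in> M \<Longrightarrow> h (q v) < h v" "v \<in> M" "q v \<in> L"
  shows "q v \<notin> M \<and> v \<notin> L"
proof
  show "q v \<notin> M"
  proof
    assume "q v \<in> M"
    have "{q (q v), q v} \<in> T" using assms(1)[OF \<open>q v \<in> M\<close>] by (simp only: insert_commute)
    then have "v = q (q v)" by (rule leaf_nbr_unique[OF assms(4) assms(1)[OF assms(3)]])
    then have "h v < h (q v)" using assms(2)[OF \<open>q v \<in> M\<close>] by metis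
    then show False using assms(2)[OF assms(3)] by (rule less_asym)
  qed
  show "v \<notin> L" using leaves_not_adjacent[of v "q v"] assms(1)[OF assms(3)] assms(4) by blast
qed

text \<open>A vertex of maximal rank on the side of \<open>a\<close> has no child, so its degree is
  at most 1. This provides the starting leaf of the ring on a prescribed side.\<close>

lemma side_has_leaf:
  assumes ab: "{a, b} \<in> T" and "a \<notin> L"
  shows "side T a b \<inter> L \<noteq> {}"
proof -
  let ?A = "side T a b"
  obtain q :: "'a \<Rightarrow> 'a" and h :: "'a \<Rightarrow> nat" where
    "\<And>v. v \<in> V - {a} - {b} \<Longrightarrow> q v \<in> V" and
    h: "\<And>v. v \<in> V - {a} - {b} \<Longrightarrow> h (q v) < h v" and
    A: "\<And>v. v \<in> V - {a} - {b} \<Longrightarrow> q v \<in> ?A \<longleftrightarrow> v \<in> ?A" and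
    T: "T = insert {a, b} ((\<lambda>v. {v, q v}) ` (V - {a} - {b}))"
    using cut_rooting[OF ab side_self] by blast
  have AV: "?A \<subseteq> V" using side_Un[OF ab] by blast
  then have finA: "finite ?A" using finite_V finite_subset by blast
  then have "Max (h ` ?A) \<in> h ` ?A" using side_self[of a T b] by (intro Max_in) auto
  then obtain z where z: "z \<in> ?A" "h z = Max (h ` ?A)" by auto
  then have max: "h v \<le> h z" if "v \<in> ?A" for v using that finA by simp
  have zb: "z \<noteq> b" using z side_self[of b T a] side_Int[OF ab] by blast
  have "nbrs T z \<subseteq> {if z = a then b else q z}"
  proof
    fix u assume "u \<in> nbrs T z"
    then have "{u, z} \<in> T" by (simp add: nbrs_def)
    then consider "{u, z} = {a, b}" | v where "v \<in> V - {a} - {b}" "{u, z} = {v, q v}"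
      using T by auto
    then show "u \<in> {if z = a then b else q z}"
    proof cases
      case 1
      then show ?thesis using zb by (auto simp: doubleton_eq_iff)
    next
      case (2 v)
      have "\<not> (u = v \<and> z = q v)"
        using A[OF 2(1)] h[OF 2(1)] max[of v] z by auto
      then show ?thesis using 2 by (auto simp: doubleton_eq_iff)
    qed
  qed
  then have "deg T z \<le> 1" 
    unfolding deg_def using card_mono[of "{if z = a then b else q z}"] by simp
  then have "z \<in> L" using inner_deg[of z] z AV by force
  then show ?thesis using z by blast
qed

text \<open>With the tree rooted at a branching vertex, the parent of another inner vertex is not a
  leaf, since only the root could be both leaf and parent.\<close>

lemma inner_edge:
  assumes "card (V - L) \<noteq> 1"
  obtains a b where "{a, b} \<in> T" "a \<notin> L" "b \<notin> L"
proof -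
  obtain c where c: "c \<in> V" "3 \<le> deg T c" using branching by blast
  then have cL: "c \<notin> L" by (auto simp: leaves_def)
  have "V - L \<noteq> {c}" using assms by auto
  then obtain d where d: "d \<in> V - {c}" "d \<notin> L" using c cL by blast
  obtain q :: "'a \<Rightarrow> 'a" and h :: "'a \<Rightarrow> nat" where
    qV: "\<And>v. v \<in> V - {c} \<Longrightarrow> q v \<in> V" and h: "\<And>v. v \<in> V - {c} \<Longrightarrow> h (q v) < h v"
    and T: "T = (\<lambda>v. {v, q v}) ` (V - {c})"
    using tree_rooting[OF c(1)] by blast
  have "q d \<notin> L"
  proof
    assume qd: "q d \<in> L"
    have "q d \<notin> V - {c} \<and> d \<notin> L"
      by (rule parent_is_leaf[where h = h and M = "V - {c}"]) (use T h d qd in auto)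
    then show False using qV[OF d(1)] qd cL by auto
  qed
  moreover have "{d, q d} \<in> T" using T d by blast
  ultimately show ?thesis using that d by blast
qed

end

section \<open>The boundary walk of a plane tree\<close>

text \<open>Transitivity makes \<open>s\<close> a single cycle. Iterates before the first return
  time \<open>N\<close> are distinct, and all others reduce to them modulo \<open>N\<close>, so
  \<open>N = card L\<close>.\<close>

lemma cyclic_enumeration:
  assumes "finite L" "x \<in> L" and maps: "\<And>y. y \<in> L \<Longrightarrow> s y \<in> L"
    and trans: "\<And>y z. y \<in> L \<Longrightarrow> z \<in> L \<Longrightarrow> \<exists>i. (s ^^ i) y = z"
  shows "inj_on (\<lambda>i. (s ^^ i) x) {..<card L}" "(\<lambda>i. (s ^^ i) x) ` {..<card L} = L"
    "(s ^^ card L) x = x"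
proof -
  obtain i where "(s ^^ i) (s x) = x" using trans[OF maps[OF assms(2)] assms(2)] by blast
  then have ex: "0 < Suc i \<and> (s ^^ Suc i) x = x" by (simp add: funpow_swap1)
  define N where "N = (LEAST N. 0 < N \<and> (s ^^ N) x = x)"
  have N: "0 < N" "(s ^^ N) x = x"
    using LeastI[of "\<lambda>N. 0 < N \<and> (s ^^ N) x = x", OF ex] by (auto simp only: N_def)
  have least: "(s ^^ m) x \<noteq> x" if "0 < m" "m < N" for m
    using not_less_Least[of m "\<lambda>N. 0 < N \<and> (s ^^ N) x = x"] that by (auto simp only: N_def)
  have inj: "inj_on (\<lambda>i. (s ^^ i) x) {..<N}"
    using inj_on_funpow_least[OF N(2) least] by (simp only: atLeast0LessThan)
  have img: "(\<lambda>i. (s ^^ i) x) ` {..<N} = L"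
  proof (intro equalityI subsetI)
    fix y assume "y \<in> (\<lambda>i. (s ^^ i) x) ` {..<N}"
    then obtain i where y: "y = (s ^^ i) x" by blast
    have "(s ^^ i) x \<in> L" by (induction i) (use assms(2) maps in auto)
    then show "y \<in> L" using y by simp
  next
    fix y assume "y \<in> L"
    then obtain i where i: "(s ^^ i) x = y" using trans[OF assms(2)] by blast
    have "(s ^^ (i mod N)) x = y" using funpow_mod_eq[OF N(2), of i] i by simp
    then show "y \<in> (\<lambda>i. (s ^^ i) x) ` {..<N}"
      using N(1) by (intro image_eqI[of _ _ "i mod N"]) simp_all
  qed
  have "card L = N" using card_image[OF inj] img by simp
  then show "inj_on (\<lambda>i. (s ^^ i) x) {..<card L}" "(\<lambda>i. (s ^^ i) x) ` {..<card L} = L"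
    "(s ^^ card L) x = x"
    using inj img N(2) by simp_all
qed

text \<open>Two iterates collide by finiteness, and injectivity cancels the common initial
  steps.\<close>

lemma funpow_periodic:
  assumes "finite A" "inj_on f A" and maps: "\<And>x. x \<in> A \<Longrightarrow> f x \<in> A" and "x \<in> A"
  shows "\<exists>N>0. (f ^^ N) x = x"
proof -
  have pow: "(f ^^ k) y \<in> A" if "y \<in> A" for k y
    by (induction k) (use that maps in auto)
  have cancel: "y = z" if "(f ^^ k) y = (f ^^ k) z" "y \<in> A" "z \<in> A" for k y z
    using that(1)
  proof (induction k)
    case (Suc k)
    then show ?case
      using inj_onD[OF assms(2), of "(f ^^ k) y" "(f ^^ k) z"] pow[OF that(2), of k] pow[OF that(3), of k]
      by simp
  qed simp
  have "\<not> inj_on (\<lambda>k. (f ^^ k) x) (UNIV :: nat set)"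
  proof
    assume "inj_on (\<lambda>k. (f ^^ k) x) (UNIV :: nat set)"
    moreover have "range (\<lambda>k. (f ^^ k) x) \<subseteq> A" using pow[OF assms(4)] by auto
    ultimately have "finite (UNIV :: nat set)" using assms(1) by (rule inj_on_finite)
    then show False by simp
  qed
  then obtain i j :: nat where "i \<noteq> j" "(f ^^ i) x = (f ^^ j) x" by (auto simp: inj_on_def)
  then obtain i j :: nat where ij: "i < j" "(f ^^ i) x = (f ^^ j) x"
    by (cases "i < j") (auto simp: not_less_iff_gr_or_eq)
  then have "(f ^^ i) x = (f ^^ i) ((f ^^ (j - i)) x)"
    by (simp flip: funpow_add comp_apply[of "f ^^ i" "f ^^ (j - i)"])
  then have "x = (f ^^ (j - i)) x" using cancel pow[OF assms(4)] assms(4) by blast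
  then show ?thesis using ij(1) by (intro exI[of _ "j - i"]) simp
qed

locale plane_tree = halin_tree +
  fixes rho :: "'a \<Rightarrow> 'a \<Rightarrow> 'a"
  assumes rotation: "rotation_system V T rho"
begin

abbreviation "\<phi> \<equiv> face_step rho"

lemma rho_edge:
  assumes "{u, v} \<in> T"
  shows "{rho v u, v} \<in> T"
proof -
  have "bij_betw (rho v) (nbrs T v) (nbrs T v)"
    using rotation edge_V[OF assms] by (auto simp: rotation_system_def)
  moreover have "u \<in> nbrs T v" using assms by (simp add: nbrs_def)
  ultimately have "rho v u \<in> nbrs T v" by (rule bij_betw_apply)
  then show ?thesis by (simp add: nbrs_def)
qed

lemma face_step_dart: "d \<in> adj T \<Longrightarrow> \<phi> d \<in> adj T"
  using rho_edge[of "fst d" "snd d"] by (auto simp: face_step_def insert_commute)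

lemma funpow_face_step_dart: "d \<in> adj T \<Longrightarrow> (\<phi> ^^ k) d \<in> adj T"
proof (induction k)
  case (Suc k)
  then show ?case using face_step_dart by (simp only: funpow.simps comp_apply)
qed simp

lemma fst_face_step: "fst (\<phi> d) = snd d"
  by (simp add: face_step_def)

lemma face_step_inj: "inj_on \<phi> (adj T)"
proof (rule inj_onI)
  fix d d' assume *: "d \<in> adj T" "d' \<in> adj T" "\<phi> d = \<phi> d'"
  have s: "snd d = snd d'" using *(3) by (simp add: face_step_def)
  have r: "rho (snd d) (fst d) = rho (snd d) (fst d')" using *(3) s by (simp add: face_step_def)
  have "inj_on (rho (snd d)) (nbrs T (snd d))"
    using rotation *(1) edge_V[of "fst d" "snd d"] by (auto simp: rotation_system_def bij_betw_def)
  moreover have "fst d \<in> nbrs T (snd d)" "fst d' \<in> nbrs T (snd d)"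
    using * s by (auto simp: nbrs_def)
  ultimately have "fst d = fst d'" using r by (simp add: inj_on_eq_iff)
  then show "d = d'" using s by (simp add: prod_eq_iff)
qed

lemma finite_darts: "finite (adj T)"
  using edge_V by (intro finite_arcs[OF finite_V]) auto

text \<open>The boundary walk through \<open>(a, b)\<close> is closed, and it can come back over the
  bridge \<open>{a, b}\<close> only along \<open>(b, a)\<close>.\<close>

lemma face_walk_reverses:
  assumes ab: "{a, b} \<in> T"
  shows "\<exists>k. (\<phi> ^^ k) (a, b) = (b, a)"
proof (rule ccontr)
  assume no: "\<nexists>k. (\<phi> ^^ k) (a, b) = (b, a)"
  obtain N where N: "0 < N" "(\<phi> ^^ N) (a, b) = (a, b)"
    using funpow_periodic[OF finite_darts face_step_inj face_step_dart, of "(a, b)"] ab by auto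
  let ?B = "side T b a"
  have aB: "a \<notin> ?B" using side_Int[OF ab] side_self[of a T b] by blast
  \<comment> \<open>As long as \<open>(b, a)\<close> is not traversed, all darts after the first
    start on the side of \<open>b\<close>. The walk could then never return to its first
    dart.\<close>
  have "fst ((\<phi> ^^ Suc k) (a, b)) \<in> ?B" for k
  proof (induction k)
    case 0
    then show ?case by (simp add: face_step_def side_self)
  next
    case (Suc k)
    define d where "d = (\<phi> ^^ Suc k) (a, b)"
    have dT: "{fst d, snd d} \<in> T"
      using funpow_face_step_dart[of "(a, b)" "Suc k"] ab unfolding d_def[symmetric] by (cases d) auto
    have dB: "fst d \<in> ?B" using Suc unfolding d_def .
    have "{fst d, snd d} \<noteq> {b, a}"
    proof
      assume "{fst d, snd d} = {b, a}"
      then have "d = (b, a)" using aB dB by (auto simp: doubleton_eq_iff prod_eq_iff)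
      then show False using no unfolding d_def by blast
    qed
    then have "snd d \<in> ?B" using side_step[OF dB dT] by blast
    then have "fst (\<phi> d) \<in> ?B" by (simp only: fst_face_step)
    then show ?case unfolding d_def by (simp only: funpow.simps comp_apply)
  qed
  from this[of "N - 1"] have "fst ((\<phi> ^^ N) (a, b)) \<in> ?B" using N(1) by simp
  then show False using N(2) aB by simp
qed

definition same_face :: "'a \<times> 'a \<Rightarrow> 'a \<times> 'a \<Rightarrow> bool" where
  "same_face d d' \<longleftrightarrow> (\<exists>k. (\<phi> ^^ k) d = d')"

lemma same_face_trans: "same_face d d' \<Longrightarrow> same_face d' d'' \<Longrightarrow> same_face d d''"
  unfolding same_face_def by (metis funpow_add comp_apply)

lemma same_face_step: "same_face d (\<phi> d)"
  unfolding same_face_def by (rule exI[of _ 1]) simp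

text \<open>The walk from \<open>(u, z)\<close> reaches \<open>(z, u)\<close>, and its next step is
  \<open>(u, rho u z)\<close>. Since the rotation at \<open>u\<close> is cyclic, iterating this
  reaches every dart out of \<open>u\<close>.\<close>

lemma same_face_at_vertex:
  assumes uv: "{u, v} \<in> T" and uw: "{u, w} \<in> T"
  shows "same_face (u, v) (u, w)"
proof -
  have step: "same_face (u, z) (u, rho u z)" if "{u, z} \<in> T" for z
    using same_face_trans[OF _ same_face_step, of "(u, z)" "(z, u)"] face_walk_reverses[OF that]
    by (simp add: same_face_def face_step_def)
  have v: "v \<in> nbrs T u" and w: "w \<in> nbrs T u" using uv uw by (simp_all add: nbrs_def insert_commute)
  have "\<exists>k. (rho u ^^ k) v = w"
    using rotation edge_V[OF uv] v w by (auto simp: rotation_system_def)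
  then obtain k where k: "(rho u ^^ k) v = w" by blast
  have "{u, (rho u ^^ i) v} \<in> T \<and> same_face (u, v) (u, (rho u ^^ i) v)" for i
  proof (induction i)
    case 0
    then show ?case using uv by (auto simp: same_face_def intro: exI[of _ 0])
  next
    case (Suc i)
    have "{rho u ((rho u ^^ i) v), u} \<in> T"
      using Suc by (intro rho_edge) (simp add: insert_commute)
    then show ?case
      using Suc same_face_trans[OF _ step[of "(rho u ^^ i) v"]] by (simp add: insert_commute)
  qed
  then show ?thesis using k by metis
qed

text \<open>The property spreads along tree edges: \<open>(y, z)\<close> is reversed to
  \<open>(z, y)\<close>, and from there the walk reaches every dart out of \<open>z\<close>.\<close>

lemma single_face:
  assumes "{u, v} \<in> T" "{u', v'} \<in> T"
  shows "same_face (u, v) (u', v')"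
proof -
  have "\<forall>w. {z, w} \<in> T \<longrightarrow> same_face (u, v) (z, w)" if "(u, z) \<in> (adj T)\<^sup>*" for z
    using that
  proof (induction rule: rtrancl_induct)
    case base
    then show ?case using same_face_at_vertex[OF assms(1)] by blast
  next
    case (step y z)
    have yz: "{y, z} \<in> T" using step.hyps by simp
    show ?case
    proof (intro allI impI)
      fix w assume "{z, w} \<in> T"
      moreover have "{z, y} \<in> T" using yz by (simp add: insert_commute)
      ultimately have "same_face (z, y) (z, w)" by (rule same_face_at_vertex[rotated])
      moreover have "same_face (y, z) (z, y)"
        unfolding same_face_def by (rule face_walk_reverses[OF yz])
      ultimately show "same_face (u, v) (z, w)"
        using step.IH yz same_face_trans by blast
    qed
  qed
  then show ?thesis using reach edge_V[OF assms(1)] edge_V[OF assms(2)] assms(2) by blast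
qed

section \<open>The cyclic order of the leaves\<close>

definition next_leaf :: "'a \<Rightarrow> 'a" where
  "next_leaf x = (SOME y. leaf_succ V T rho x y)"

text \<open>A leaf has a single neighbour, so both walks start with the same dart, and both lengths
  are the first time a leaf is hit.\<close>

lemma leaf_succ_unique:
  assumes "leaf_succ V T rho x y" "leaf_succ V T rho x z"
  shows "y = z"
proof -
  obtain p k where 1: "{x, p} \<in> T" "0 < k" "snd ((\<phi> ^^ k) (x, p)) = y" "y \<in> L"
    "\<forall>j. 0 < j \<and> j < k \<longrightarrow> snd ((\<phi> ^^ j) (x, p)) \<notin> L"
    using assms(1) unfolding leaf_succ_def by blast
  obtain p' k' where 2: "{x, p'} \<in> T" "0 < k'" "snd ((\<phi> ^^ k') (x, p')) = z" "z \<in> L"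
    "\<forall>j. 0 < j \<and> j < k' \<longrightarrow> snd ((\<phi> ^^ j) (x, p')) \<notin> L"
    using assms(2) unfolding leaf_succ_def by blast
  have x: "x \<in> L" using assms(1) unfolding leaf_succ_def by blast
  have p: "p' = p" using leaf_nbr_unique[OF x, of p' p] 1(1) 2(1) by (simp add: insert_commute)
  have "\<not> k < k'" using 1 2(5) unfolding p by blast
  moreover have "\<not> k' < k" using 1(5) 2 unfolding p by blast
  ultimately have "k = k'" by simp
  then show ?thesis using 1(3) 2(3) unfolding p by simp
qed

lemma first_leaf_on_walk:
  assumes "x \<in> L" "{x, p} \<in> T" "0 < k" "snd ((\<phi> ^^ k) (x, p)) \<in> L"
  obtains m where "0 < m" "m \<le> k" "leaf_succ V T rho x (snd ((\<phi> ^^ m) (x, p)))"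
proof -
  let ?P = "\<lambda>m. 0 < m \<and> snd ((\<phi> ^^ m) (x, p)) \<in> L"
  define m where "m = (LEAST m. ?P m)"
  have m: "?P m" unfolding m_def by (rule LeastI[of ?P k]) (use assms in simp)
  have "m \<le> k" unfolding m_def by (rule Least_le) (use assms in simp)
  moreover have "\<not> ?P j" if "j < m" for j using not_less_Least that unfolding m_def by blast
  then have "leaf_succ V T rho x (snd ((\<phi> ^^ m) (x, p)))"
    using assms(1,2) m unfolding leaf_succ_def by blast
  ultimately show ?thesis using m that by blast
qed

text \<open>The walk comes back to \<open>x\<close> itself by \<open>face_walk_reverses\<close>, so
  it certainly meets a leaf.\<close>

lemma leaf_succ_ex:
  assumes x: "x \<in> L"
  shows "\<exists>y. leaf_succ V T rho x y"
proof -
  obtain p where p: "{x, p} \<in> T" using leaf_nbr_ex[OF x] by blast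
  obtain k where k: "(\<phi> ^^ k) (x, p) = (p, x)" using face_walk_reverses[OF p] by blast
  have "k \<noteq> 0" using k edge_V[OF p] by (intro notI) simp
  then show ?thesis using first_leaf_on_walk[OF x p, of k] k x by auto
qed

lemma leaf_succ_iff: "leaf_succ V T rho x y \<longleftrightarrow> x \<in> L \<and> y = next_leaf x"
proof
  assume xy: "leaf_succ V T rho x y"
  then have "leaf_succ V T rho x (next_leaf x)" unfolding next_leaf_def by (rule someI)
  then have "y = next_leaf x" by (rule leaf_succ_unique[OF xy])
  moreover have "x \<in> L" using xy unfolding leaf_succ_def by blast
  ultimately show "x \<in> L \<and> y = next_leaf x" by blast
next
  assume xy: "x \<in> L \<and> y = next_leaf x"
  then show "leaf_succ V T rho x y"
    using someI_ex[OF leaf_succ_ex] by (simp add: next_leaf_def)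
qed

lemma next_leaf_in: "x \<in> L \<Longrightarrow> next_leaf x \<in> L"
  using leaf_succ_iff[of x "next_leaf x"] unfolding leaf_succ_def by blast

text \<open>The walk is cut at its first leaf, which is \<open>next_leaf x\<close>, and the
  induction continues with the shorter remainder.\<close>

lemma next_leaf_reaches:
  assumes "x \<in> L" "{x, p} \<in> T" "0 < k" "snd ((\<phi> ^^ k) (x, p)) = y" "y \<in> L"
  shows "\<exists>i. (next_leaf ^^ i) x = y"
  using assms
proof (induction k arbitrary: x p rule: less_induct)
  case (less k)
  obtain m where m: "0 < m" "m \<le> k" "leaf_succ V T rho x (snd ((\<phi> ^^ m) (x, p)))"
    using first_leaf_on_walk[OF less.prems(1-3)] less.prems(4,5) by blast
  have z: "snd ((\<phi> ^^ m) (x, p)) = next_leaf x" using m(3) by (simp only: leaf_succ_iff)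
  show ?case
  proof (cases "m = k")
    case True
    then show ?thesis using z less.prems(4) by (intro exI[of _ 1]) simp
  next
    case False
    then have mk: "m < k" using m(2) by simp
    have zL: "next_leaf x \<in> L" using next_leaf_in less.prems(1) by blast
    \<comment> \<open>One further step turns the dart arriving at the leaf into the dart leaving
      it.\<close>
    obtain w where w: "(\<phi> ^^ Suc m) (x, p) = (next_leaf x, w)"
      using fst_face_step[of "(\<phi> ^^ m) (x, p)"] z by (cases "(\<phi> ^^ Suc m) (x, p)") simp
    have wT: "{next_leaf x, w} \<in> T"
      using funpow_face_step_dart[of "(x, p)" "Suc m"] less.prems(2) unfolding w by simp
    have "(\<phi> ^^ k) (x, p) = (\<phi> ^^ (k - Suc m)) ((\<phi> ^^ Suc m) (x, p))"
      using mk by (simp flip: funpow_add comp_apply[of "\<phi> ^^ (k - Suc m)" "\<phi> ^^ Suc m"] del: funpow.simps)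
    then have end': "snd ((\<phi> ^^ (k - Suc m)) (next_leaf x, w)) = y"
      using less.prems(4) unfolding w by simp
    \<comment> \<open>Otherwise \<open>y\<close> would be the neighbour of the leaf
      \<open>next_leaf x\<close>, and two leaves would be adjacent.\<close>
    have "k - Suc m \<noteq> 0"
    proof
      assume "k - Suc m = 0"
      then have "w = y" using end' by simp
      then show False using leaves_not_adjacent[OF zL wT] less.prems(5) by simp
    qed
    then obtain i where "(next_leaf ^^ i) (next_leaf x) = y"
      using less.IH[of "k - Suc m" "next_leaf x" w] zL wT end' less.prems(5) mk by auto
    then show ?thesis by (intro exI[of _ "Suc i"]) (simp add: funpow_swap1)
  qed
qed

lemma next_leaf_transitive:
  assumes x: "x \<in> L" and y: "y \<in> L"
  shows "\<exists>i. (next_leaf ^^ i) x = y"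
proof -
  obtain p r where p: "{x, p} \<in> T" and r: "{y, r} \<in> T"
    using leaf_nbr_ex[OF x] leaf_nbr_ex[OF y] by blast
  have ry: "{r, y} \<in> T" using r by (simp only: insert_commute)
  obtain k where k: "(\<phi> ^^ k) (x, p) = (r, y)"
    using single_face[OF p ry] unfolding same_face_def by blast
  have "k \<noteq> 0"
  proof
    assume "k = 0"
    then have "p = y" using k by simp
    then show False using leaves_not_adjacent[OF x p] y by simp
  qed
  then show ?thesis using next_leaf_reaches[OF x p, of k y] k y by simp
qed

text \<open>The starting leaf is free, so that the ring can begin at the chosen root of the
  tree.\<close>

lemma leaf_cycle_enumeration:
  assumes "x \<in> L"
  obtains l :: "nat \<Rightarrow> 'a" where "l 0 = x" "inj_on l {..<card L}" "l ` {..<card L} = L"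
    "l (card L) = l 0" "leaf_cycle V T rho = (\<lambda>i. {l i, l (Suc i)}) ` {..<card L}"
proof -
  let ?l = "\<lambda>i. (next_leaf ^^ i) x"
  have finL: "finite L" using finite_V by (simp add: leaves_def)
  note enum = cyclic_enumeration[OF finL assms next_leaf_in next_leaf_transitive]
  have "leaf_cycle V T rho = (\<lambda>y. {y, next_leaf y}) ` L"
    unfolding leaf_cycle_def leaf_succ_iff by blast
  also have "\<dots> = (\<lambda>y. {y, next_leaf y}) ` ?l ` {..<card L}" by (simp only: enum(2))
  also have "\<dots> = (\<lambda>i. {?l i, ?l (Suc i)}) ` {..<card L}" by (simp add: image_image)
  finally have "leaf_cycle V T rho = (\<lambda>i. {?l i, ?l (Suc i)}) ` {..<card L}" .
  then show ?thesis
    using enum by (intro that[of ?l]) (simp_all del: funpow.simps add: funpow.simps(1))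
qed

end

section \<open>Halin graphs\<close>

text \<open>An arc into a vertex forces an arc out of it, to a vertex of smaller \<open>f\<close>,
  and so on without end.\<close>

lemma eulerian_sub_acyclic:
  fixes f :: "'a \<Rightarrow> nat"
  assumes "finite D" "D \<subseteq> V \<times> V" and f: "\<And>u v. (u, v) \<in> D \<Longrightarrow> f v < f u"
    and S: "eulerian_sub V D S"
  shows "S = {}"
proof -
  have SD: "S \<subseteq> D" and bal: "\<And>v. v \<in> V \<Longrightarrow> indeg S v = outdeg S v"
    using S by (auto simp: eulerian_sub_def)
  then have finS: "finite S" using assms(1) finite_subset by blast
  have "(u, v) \<notin> S" for u v
  proof (induction "f v" arbitrary: u v rule: less_induct)
    case less
    show ?case
    proof
      assume uv: "(u, v) \<in> S"
      then have "0 < indeg S v" using indeg_pos_iff[OF finS] by blast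
      moreover have "v \<in> V" using uv SD assms(2) by blast
      ultimately have "0 < outdeg S v" using bal by simp
      then obtain w where w: "(v, w) \<in> S" using outdeg_pos_iff[OF finS] by blast
      then have "f w < f v" using f SD by blast
      then show False using less.hyps w by blast
    qed
  qed
  then show ?thesis by auto
qed

section \<open>Orientations of Halin graphs with outdegree at most 2\<close>

context plane_tree
begin

definition H :: "'a set set" where
  "H = T \<union> leaf_cycle V T rho"

lemma L_V: "L \<subseteq> V"
  by (auto simp: leaves_def)

lemma T_cases:
  assumes "e \<in> T"
  obtains u v where "e = {u, v}" "u \<in> V" "v \<in> V" "u \<noteq> v"
  using assms is_tree unfolding is_tree_def simple_graph_def by blast

context
  fixes l :: "nat \<Rightarrow> 'a"
  assumes inj_l: "inj_on l {..<card L}" and l_L: "l ` {..<card L} = L" and l_closed: "l (card L) = l 0"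
    and cycle: "leaf_cycle V T rho = (\<lambda>i. {l i, l (Suc i)}) ` {..<card L}"
begin

lemma l_in: "i \<le> card L \<Longrightarrow> l i \<in> L"
proof (cases "i = card L")
  case True
  have "0 < card L" using leaf_count by simp
  then show ?thesis using l_L l_closed True by (metis imageI lessThan_iff)
qed (use l_L in force)

lemma l_Suc_eq:
  assumes "i < card L" "j < card L" "l (Suc j) = l i"
  shows "j = (if i = 0 then card L - 1 else i - 1)"
proof (cases "Suc j = card L")
  case True
  then have "l 0 = l i" using assms(3) l_closed by simp
  then have "i = 0" using inj_onD[OF inj_l, of 0 i] assms(1) by auto
  then show ?thesis using True by simp
next
  case False
  then have "Suc j = i" using inj_onD[OF inj_l, of "Suc j" i] assms by auto
  then show ?thesis by auto
qed

lemma l_Suc_neq: "i < card L \<Longrightarrow> l i \<noteq> l (Suc i)"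
  using l_Suc_eq[of i i] leaf_count by (auto split: if_splits)

lemma H_edge:
  assumes "e \<in> H"
  shows "\<exists>u v. e = {u, v} \<and> u \<in> V \<and> v \<in> V \<and> u \<noteq> v"
proof (cases "e \<in> T")
  case True
  then show ?thesis by (rule T_cases) blast
next
  case False
  then obtain i where i: "i < card L" "e = {l i, l (Suc i)}" using assms cycle by (auto simp: H_def)
  then show ?thesis using l_in[of i] l_in[of "Suc i"] L_V l_Suc_neq[OF i(1)] by auto
qed

lemma orientation_sub:
  assumes "orientation H D"
  shows "D \<subseteq> V \<times> V"
proof
  fix d assume "d \<in> D"
  moreover obtain u v where d: "d = (u, v)" by (cases d)
  ultimately have "{u, v} \<in> H" using assms by (auto simp: orientation_def)
  then show "d \<in> V \<times> V" using H_edge[of "{u, v}"] d by (auto simp: doubleton_eq_iff)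
qed

text \<open>The tree has \<open>card V - 1\<close> edges, and ring edges are not tree edges since
  leaves are not adjacent in \<open>T\<close>; two of them already suffice.\<close>

lemma card_H: "card V < card H"
proof -
  have n: "3 \<le> card L" by (rule leaf_count)
  have "l 0 \<noteq> l 1" "l 0 \<noteq> l 2"
    using inj_onD[OF inj_l, of 0 1] inj_onD[OF inj_l, of 0 2] n by auto
  then have two: "card {{l 0, l 1}, {l 1, l 2}} = 2" by (auto simp: doubleton_eq_iff)
  have sub: "{{l 0, l 1}, {l 1, l 2}} \<subseteq> leaf_cycle V T rho"
    unfolding cycle using n by (auto simp: numeral_2_eq_2)
  have fin: "finite (leaf_cycle V T rho)" unfolding cycle by simp
  have "2 \<le> card (leaf_cycle V T rho)" using card_mono[OF fin sub] two by simp
  moreover have "T \<inter> leaf_cycle V T rho = {}"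
  proof (rule ccontr)
    assume "T \<inter> leaf_cycle V T rho \<noteq> {}"
    then obtain i where i: "i < card L" "{l i, l (Suc i)} \<in> T" unfolding cycle by blast
    then show False using leaves_not_adjacent[OF l_in[of i], of "l (Suc i)"] l_in[of "Suc i"] by simp
  qed
  then have "card H = card T + card (leaf_cycle V T rho)"
    unfolding H_def by (rule card_Un_disjoint[OF finite_T fin])
  ultimately show ?thesis using card_T by simp
qed

text \<open>Outdegrees at most 1 would bound the number of edges by \<open>card V\<close>.\<close>

lemma outdeg_ge_2:
  assumes "orientation H D"
  shows "\<exists>v\<in>V. 2 \<le> outdeg D v"
proof (rule ccontr)
  assume "\<not> ?thesis"
  then have le: "outdeg D v \<le> 1" if "v \<in> V" for v using that by force
  have D: "D \<subseteq> V \<times> V" by (rule orientation_sub[OF assms])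
  have "H \<subseteq> (\<lambda>(u, v). {u, v}) ` D"
  proof
    fix e assume e: "e \<in> H"
    then obtain u v where uv: "e = {u, v}" using H_edge by blast
    then have "(u, v) \<in> D \<or> (v, u) \<in> D" using e assms unfolding orientation_def by blast
    then show "e \<in> (\<lambda>(u, v). {u, v}) ` D" using uv by (auto simp: image_iff insert_commute)
  qed
  then have "card H \<le> card D" using finite_arcs[OF finite_V D] by (metis card_image_le card_mono finite_imageI le_trans)
  also have "\<dots> = (\<Sum>v\<in>V. outdeg D v)" using sum_outdeg[OF finite_V D] by simp
  also have "\<dots> \<le> (\<Sum>v\<in>V. 1)" using le by (rule sum_mono)
  finally show False using card_H by simp
qed

lemma orientation_of_leaf_ring:
  assumes "leaf_ring V A R X l (card L) q h"
    and T: "T = (\<lambda>v. {v, q v}) ` (V - {l 0} - R) \<union> (\<lambda>(a, b). {a, b}) ` X"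
    and "even (card (L \<inter> A))"
  shows "\<exists>D. orientation H D \<and> (\<forall>v\<in>V. outdeg D v < 3) \<and> even_eulerian V D \<noteq> odd_eulerian V D"
proof -
  interpret ring: leaf_ring V A R X l "card L" q h by (rule assms(1))
  have "H = (\<lambda>(u, v). {u, v}) ` ring.D"
    unfolding H_def cycle by (subst T) (auto simp: ring.D_def image_Un image_image)
  then have "H = {{u, v} | u v. (u, v) \<in> ring.D}" by auto
  then have "orientation H ring.D" by (rule ring.orientation_D)
  moreover have "outdeg ring.D v < 3" for v using ring.outdeg_D[of v] by simp
  moreover have "even_eulerian V ring.D \<noteq> odd_eulerian V ring.D"
    using ring.even_ne_odd_eulerian_D assms(3) unfolding l_L .
  ultimately show ?thesis by blast
qed

text \<open>The whole tree is rooted at \<open>l 0\<close>, so every leaf is a possible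
  exit.\<close>

lemma orientation_even:
  assumes "even (card L)"
  shows "\<exists>D. orientation H D \<and> (\<forall>v\<in>V. outdeg D v < 3) \<and> even_eulerian V D \<noteq> odd_eulerian V D"
proof -
  have l0: "l 0 \<in> V" using l_in[of 0] L_V by auto
  obtain q :: "'a \<Rightarrow> 'a" and h :: "'a \<Rightarrow> nat" where
    qV: "\<And>v. v \<in> V - {l 0} \<Longrightarrow> q v \<in> V" and h: "\<And>v. v \<in> V - {l 0} \<Longrightarrow> h (q v) < h v"
    and T: "T = (\<lambda>v. {v, q v}) ` (V - {l 0})"
    using tree_rooting[OF l0] by blast
  have qT: "{v, q v} \<in> T" if "v \<in> V - {l 0}" for v using T that by blast
  have qL: "q v = l 0 \<and> v \<notin> L" if "v \<in> V - {l 0}" "q v \<in> L" for v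
    using parent_is_leaf[of _ q h, OF qT h that] qV[OF that(1)] by blast
  show ?thesis
  proof (rule orientation_of_leaf_ring)
    show "leaf_ring V V {} {} l (card L) q h"
    proof (rule leaf_ring.intro, unfold l_L)
      show "finite V" by (rule finite_V)
      show "3 \<le> card L" by (rule leaf_count)
      show "inj_on l {..<card L}" by (rule inj_l)
      show "l (card L) = l 0" by (rule l_closed)
      show "L \<subseteq> V" by (rule L_V)
      show "l 0 \<in> V" by (rule l0)
      show "q v \<in> V" if "v \<in> V - {l 0} - {}" for v using qV that by simp
      show "h (q v) < h v" if "v \<in> V - {l 0} - {}" for v using h that by simp
      show "q v \<in> V \<longleftrightarrow> v \<in> V" if "v \<in> V - {l 0} - {}" for v using qV that by simp
      show "q v = l 0 \<and> v \<notin> L" if "v \<in> V - {l 0} - {}" "q v \<in> L" for v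
        using qL[of v] that by simp
    qed simp_all
    show "T = (\<lambda>v. {v, q v}) ` (V - {l 0} - {}) \<union> (\<lambda>(a, b). {a, b}) ` {}" using T by simp
    show "even (card (L \<inter> V))" using assms L_V by (simp add: Int_absorb2)
  qed
qed

text \<open>The tree is cut at \<open>{a, b}\<close>, so only leaves on the side of \<open>a\<close>
  count as exits.\<close>

lemma orientation_even_side:
  assumes ab: "{a, b} \<in> T" "a \<notin> L" "b \<notin> L" and "even (card (L \<inter> side T a b))"
    and x: "l 0 \<in> side T a b"
  shows "\<exists>D. orientation H D \<and> (\<forall>v\<in>V. outdeg D v < 3) \<and> even_eulerian V D \<noteq> odd_eulerian V D"
proof -
  let ?A = "side T a b" and ?M = "V - {l 0} - {b}"
  obtain q :: "'a \<Rightarrow> 'a" and h :: "'a \<Rightarrow> nat" where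
    qV: "\<And>v. v \<in> ?M \<Longrightarrow> q v \<in> V" and h: "\<And>v. v \<in> ?M \<Longrightarrow> h (q v) < h v"
    and qA: "\<And>v. v \<in> ?M \<Longrightarrow> q v \<in> ?A \<longleftrightarrow> v \<in> ?A"
    and T: "T = insert {a, b} ((\<lambda>v. {v, q v}) ` ?M)"
    using cut_rooting[OF ab(1) x] by blast
  have qT: "{v, q v} \<in> T" if "v \<in> ?M" for v using T that by blast
  have qL: "q v = l 0 \<and> v \<notin> L" if "v \<in> ?M" "q v \<in> L" for v
    using parent_is_leaf[of _ q h, OF qT h that] qV[OF that(1)] that(2) ab(3) by blast
  have bA: "b \<notin> ?A" using side_Int[OF ab(1)] side_self[of b T a] by blast
  have AV: "?A \<subseteq> V" using side_Un[OF ab(1)] by blast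
  show ?thesis
  proof (rule orientation_of_leaf_ring)
    show "leaf_ring V ?A {b} {(a, b)} l (card L) q h"
    proof (rule leaf_ring.intro, unfold l_L)
      show "finite V" by (rule finite_V)
      show "3 \<le> card L" by (rule leaf_count)
      show "inj_on l {..<card L}" by (rule inj_l)
      show "l (card L) = l 0" by (rule l_closed)
      show "L \<subseteq> V" by (rule L_V)
      show "?A \<subseteq> V" by (rule AV)
      show "l 0 \<in> ?A" by (rule x)
      show "{b} \<subseteq> V - ?A - L" using bA ab edge_V by blast
      show "{(a, b)} \<subseteq> (?A - L) \<times> {b}" using side_self[of a T b] ab(2) by simp
      show "b1 = b2" if "(a', b1) \<in> {(a, b)}" "(a', b2) \<in> {(a, b)}" for a' b1 b2
        using that by simp
      show "q v \<in> V" if "v \<in> ?M" for v by (rule qV[OF that])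
      show "h (q v) < h v" if "v \<in> ?M" for v by (rule h[OF that])
      show "q v \<in> ?A \<longleftrightarrow> v \<in> ?A" if "v \<in> ?M" for v by (rule qA[OF that])
      show "q v = l 0 \<and> v \<notin> L" if "v \<in> ?M" "q v \<in> L" for v by (rule qL[OF that])
    qed
    show "T = (\<lambda>v. {v, q v}) ` ?M \<union> (\<lambda>(a, b). {a, b}) ` {(a, b)}" using T by simp
  qed fact
qed

end

lemma alon_tarsi_eq_3:
  assumes "even (card L) \<or> card (V - L) \<noteq> 1"
  shows "alon_tarsi V H = 3"
  unfolding alon_tarsi_def
proof (rule Least_equality)
  have "L \<noteq> {}" using leaf_count by auto
  then obtain x where x: "x \<in> L" by blast
  show "\<exists>D. orientation H D \<and> (\<forall>v\<in>V. outdeg D v < 3) \<and> even_eulerian V D \<noteq> odd_eulerian V D"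
  proof (cases "even (card L)")
    case True
    obtain l where "l 0 = x" and l: "inj_on l {..<card L}" "l ` {..<card L} = L"
      "l (card L) = l 0" "leaf_cycle V T rho = (\<lambda>i. {l i, l (Suc i)}) ` {..<card L}"
      by (rule leaf_cycle_enumeration[OF x])
    show ?thesis by (rule orientation_even[OF l True])
  next
    case False
    then obtain a b where ab: "{a, b} \<in> T" "a \<notin> L" "b \<notin> L" using inner_edge assms by blast
    have "card L = card (L \<inter> side T a b) + card (L \<inter> side T b a)"
    proof -
      have "L = (L \<inter> side T a b) \<union> (L \<inter> side T b a)" using side_Un[OF ab(1)] L_V by blast
      moreover have "finite L" using finite_V L_V finite_subset by blast
      ultimately show ?thesis
        using card_Un_disjoint[of "L \<inter> side T a b" "L \<inter> side T b a"] side_Int[OF ab(1)] by auto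
    qed
    \<comment> \<open>An odd number of leaves splits into one odd and one even part; the ends of the
      edge are then named so that \<open>a'\<close> is on the even side.\<close>
    then have "even (card (L \<inter> side T a b)) \<or> even (card (L \<inter> side T b a))"
      using False by presburger
    then obtain a' b' where ab': "{a', b'} \<in> T" "a' \<notin> L" "b' \<notin> L" "even (card (L \<inter> side T a' b'))"
      using ab by (metis insert_commute)
    obtain y where y: "y \<in> side T a' b'" "y \<in> L" using side_has_leaf[OF ab'(1,2)] by blast
    obtain l where l0: "l 0 = y" and l: "inj_on l {..<card L}" "l ` {..<card L} = L"
      "l (card L) = l 0" "leaf_cycle V T rho = (\<lambda>i. {l i, l (Suc i)}) ` {..<card L}"
      by (rule leaf_cycle_enumeration[OF y(2)])
    show ?thesis by (rule orientation_even_side[OF l ab']) (simp add: l0 y)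
  qed
  fix k assume "\<exists>D. orientation H D \<and> (\<forall>v\<in>V. outdeg D v < k) \<and> even_eulerian V D \<noteq> odd_eulerian V D"
  then obtain D where D: "orientation H D" "\<forall>v\<in>V. outdeg D v < k" by blast
  obtain l where "l 0 = x" and l: "inj_on l {..<card L}" "l ` {..<card L} = L"
    "l (card L) = l 0" "leaf_cycle V T rho = (\<lambda>i. {l i, l (Suc i)}) ` {..<card L}"
    by (rule leaf_cycle_enumeration[OF x])
  obtain v where "v \<in> V" "2 \<le> outdeg D v" using outdeg_ge_2[OF l D(1)] by blast
  then have "2 < k" using D(2) by force
  then show "3 \<le> k" by simp
qed

section \<open>Wheels\<close>

context
  fixes c :: 'a
  assumes hub: "V - L = {c}"
begin

lemma hub_edge: "x \<in> L \<Longrightarrow> {x, c} \<in> T"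
proof -
  assume x: "x \<in> L"
  then obtain u where u: "{x, u} \<in> T" using leaf_nbr_ex by blast
  then have "u \<in> V - L" using leaves_not_adjacent[OF x u] edge_V[OF u] by blast
  then show ?thesis using u hub by simp
qed

text \<open>The hub uses up one colour, so the rim would alternate between the other two, which
  fails to close up after an odd number of steps.\<close>

lemma wheel_not_3_colourable:
  fixes col :: "'a \<Rightarrow> nat"
  assumes "odd (card L)" and lt: "\<And>v. v \<in> V \<Longrightarrow> col v < 3"
  shows "\<exists>u v. {u, v} \<in> H \<and> col u = col v"
proof (rule ccontr)
  assume "\<not> ?thesis"
  then have proper: "col u \<noteq> col v" if "{u, v} \<in> H" for u v using that by blast
  have "L \<noteq> {}" using leaf_count by auto
  then obtain x where x: "x \<in> L" by blast
  obtain l where "l 0 = x" and l: "inj_on l {..<card L}" "l ` {..<card L} = L"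
    "l (card L) = l 0" "leaf_cycle V T rho = (\<lambda>i. {l i, l (Suc i)}) ` {..<card L}"
    by (rule leaf_cycle_enumeration[OF x])
  have c: "col c < 3" using lt hub by blast
  have leaf: "col (l i) < 3 \<and> col (l i) \<noteq> col c" if "i \<le> card L" for i
    using l_in[OF l that] L_V lt proper[of "l i" c] hub_edge by (auto simp: H_def)
  have "col (l i) = col (l 0) \<longleftrightarrow> even i" if "i \<le> card L" for i
    using that
  proof (induction i)
    case (Suc i)
    have "{l i, l (Suc i)} \<in> H" using Suc.prems l(4) by (auto simp: H_def)
    then have "col (l i) \<noteq> col (l (Suc i))" by (rule proper)
    moreover have "col (l i) < 3" "col (l i) \<noteq> col c" "col (l (Suc i)) < 3" "col (l (Suc i)) \<noteq> col c"
      "col (l 0) < 3" "col (l 0) \<noteq> col c"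
      using leaf[of i] leaf[of "Suc i"] leaf[of 0] Suc.prems by simp_all
    ultimately have "col (l (Suc i)) = col (l 0) \<longleftrightarrow> col (l i) \<noteq> col (l 0)" using c by linarith
    then show ?case using Suc by simp
  qed simp
  from this[of "card L"] show False using l(3) assms(1) by simp
qed

lemma wheel_acyclic_orientation:
  "\<exists>D. orientation H D \<and> (\<forall>v\<in>V. outdeg D v < 4) \<and> even_eulerian V D \<noteq> odd_eulerian V D"
proof -
  have "L \<noteq> {}" using leaf_count by auto
  then obtain x where x: "x \<in> L" by blast
  obtain l where "l 0 = x" and l: "inj_on l {..<card L}" "l ` {..<card L} = L"
    "l (card L) = l 0" "leaf_cycle V T rho = (\<lambda>i. {l i, l (Suc i)}) ` {..<card L}"
    by (rule leaf_cycle_enumeration[OF x])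
  \<comment> \<open>\<open>Suc\<close> keeps rim ranks above the rank 0 of the hub. The hub thus
    becomes a sink, and a rim vertex has at most its three neighbours as out-neighbours.\<close>
  define f where "f = (\<lambda>v. if v = c then 0 else Suc (the_inv_into {..<card L} l v))"
  define D where "D = {(u, v). {u, v} \<in> H \<and> f v < f u}"
  have f_neq: "f u \<noteq> f v" if uv: "u \<in> V" "v \<in> V" "u \<noteq> v" for u v
  proof
    assume eq: "f u = f v"
    then have "u \<noteq> c" "v \<noteq> c" using uv by (auto simp: f_def split: if_splits)
    then have "u \<in> l ` {..<card L}" "v \<in> l ` {..<card L}" using uv hub l(2) by auto
    moreover have "the_inv_into {..<card L} l u = the_inv_into {..<card L} l v"
      using eq \<open>u \<noteq> c\<close> \<open>v \<noteq> c\<close> by (simp add: f_def)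
    ultimately show False using uv(3) f_the_inv_into_f[OF l(1)] by metis
  qed
  have "f u \<noteq> f v" if "{u, v} \<in> H" for u v
    using H_edge[OF l that] f_neq by (auto simp: doubleton_eq_iff)
  then have "orientation H D"
    unfolding orientation_def D_def by (auto simp: insert_commute not_less_iff_gr_or_eq)
  moreover have "outdeg D v < 4" if v: "v \<in> V" for v
  proof (cases "v = c")
    case True
    then have "{w. (v, w) \<in> D} = {}" by (auto simp: D_def f_def)
    then show ?thesis by (simp add: outdeg_def)
  next
    case False
    then have "v \<in> l ` {..<card L}" using v hub l(2) by auto
    then obtain i where i: "i < card L" "v = l i" by blast
    let ?N = "{c, l (Suc i), l (if i = 0 then card L - 1 else i - 1)}"
    have "w \<in> ?N" if "(v, w) \<in> D" for w
    proof -
      have vw: "{v, w} \<in> T \<or> {v, w} \<in> leaf_cycle V T rho" using that by (auto simp: D_def H_def)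
      have vL: "v \<in> L" using i l(2) by blast
      from vw show ?thesis
      proof
        assume vw: "{v, w} \<in> T"
        then have "w \<in> V - L" using leaves_not_adjacent[OF vL vw] edge_V[OF vw] by blast
        then show ?thesis using hub by simp
      next
        assume "{v, w} \<in> leaf_cycle V T rho"
        then obtain j where j: "j < card L" "{v, w} = {l j, l (Suc j)}" unfolding l(4) by blast
        then consider "l i = l j" "w = l (Suc j)" | "l (Suc j) = l i" "w = l j"
          using i(2) by (auto simp: doubleton_eq_iff)
        then show ?thesis
        proof cases
          case 1
          then have "i = j" using inj_onD[OF l(1), of i j] i j by simp
          then show ?thesis using 1 by simp
        next
          case 2
          then show ?thesis using l_Suc_eq[OF l i(1) j(1)] by simp
        qed
      qed
    qed
    then have "{w. (v, w) \<in> D} \<subseteq> ?N" by blast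
    then have "outdeg D v \<le> card ?N" unfolding outdeg_def by (intro card_mono) simp_all
    also have "\<dots> \<le> 3" by (simp add: card_insert_if)
    finally show ?thesis by simp
  qed
  moreover have "even_eulerian V D \<noteq> odd_eulerian V D"
  proof -
    have DV: "D \<subseteq> V \<times> V" by (rule orientation_sub[OF l \<open>orientation H D\<close>])
    have fin: "finite D" by (rule finite_arcs[OF finite_V DV])
    have "S = {}" if "eulerian_sub V D S" for S
      by (rule eulerian_sub_acyclic[OF fin DV _ that, of f]) (simp add: D_def)
    moreover have "eulerian_sub V D {}" by (simp add: eulerian_sub_def indeg_def outdeg_def)
    ultimately have "{S. eulerian_sub V D S} = {{}}" by blast
    then show ?thesis by (intro even_ne_odd_eulerian[OF fin]) simp
  qed
  ultimately show ?thesis by blast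
qed

text \<open>Outdegrees below 3 with unbalanced counts would yield a proper 3-colouring by
  \<open>eulerian_balanced_if_not_colourable\<close>.\<close>

lemma alon_tarsi_wheel_eq_4:
  assumes "odd (card L)"
  shows "alon_tarsi V H = 4"
  unfolding alon_tarsi_def
proof (rule Least_equality)
  show "\<exists>D. orientation H D \<and> (\<forall>v\<in>V. outdeg D v < 4) \<and> even_eulerian V D \<noteq> odd_eulerian V D"
    by (rule wheel_acyclic_orientation)
  fix k assume "\<exists>D. orientation H D \<and> (\<forall>v\<in>V. outdeg D v < k) \<and> even_eulerian V D \<noteq> odd_eulerian V D"
  then obtain D where D: "orientation H D" "\<forall>v\<in>V. outdeg D v < k"
    "even_eulerian V D \<noteq> odd_eulerian V D" by blast
  have "L \<noteq> {}" using leaf_count by auto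
  then obtain x where x: "x \<in> L" by blast
  obtain l where "l 0 = x" and l: "inj_on l {..<card L}" "l ` {..<card L} = L"
    "l (card L) = l 0" "leaf_cycle V T rho = (\<lambda>i. {l i, l (Suc i)}) ` {..<card L}"
    by (rule leaf_cycle_enumeration[OF x])
  show "4 \<le> k"
  proof (rule ccontr)
    assume "\<not> 4 \<le> k"
    then have out: "outdeg D v < 3" if "v \<in> V" for v using D(2) that by force
    have col: "\<exists>(u, v)\<in>D. col u = col v" if lt: "\<And>v. v \<in> V \<Longrightarrow> col v < 3" for col :: "'a \<Rightarrow> nat"
    proof -
      obtain u v where uv: "{u, v} \<in> H" "col u = col v"
        using wheel_not_3_colourable[of col, OF assms lt] by blast
      then have "(u, v) \<in> D \<or> (v, u) \<in> D" using D(1) unfolding orientation_def by blast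
      then show ?thesis
      proof
        assume "(u, v) \<in> D"
        then show ?thesis using uv(2) by (intro bexI[of _ "(u, v)"]) simp_all
      next
        assume "(v, u) \<in> D"
        then show ?thesis using uv(2) by (intro bexI[of _ "(v, u)"]) simp_all
      qed
    qed
    have "even_eulerian V D = odd_eulerian V D"
      by (rule eulerian_balanced_if_not_colourable[OF finite_V orientation_sub[OF l D(1)] out col])
    then show False using D(3) by blast
  qed
qed

end

end

lemma plane_tree_of_halin_decomp:
  assumes "halin_decomp V E T rho"
  shows "plane_tree V T rho" "E = plane_tree.H V T rho"
proof -
  show *: "plane_tree V T rho"
    using assms unfolding halin_decomp_def by unfold_locales auto
  show "E = plane_tree.H V T rho"
    using assms unfolding halin_decomp_def plane_tree.H_def[OF *] by blast
qed

theorem mainTheorem1: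
  fixes V :: "'a set" and E :: "'a set set"
  assumes "finite V" and "halin V E"
  shows "alon_tarsi V E = (if wheel V E \<and> even (card V) then 4 else 3)"
proof (cases "wheel V E \<and> even (card V)")
  case True
  then obtain T rho where dec: "halin_decomp V E T rho" and one: "card (V - leaves V T) = 1"
    unfolding wheel_def by blast
  interpret plane_tree V T rho by (rule plane_tree_of_halin_decomp[OF dec])
  obtain c where c: "V - L = {c}" using one by (auto simp: card_1_singleton_iff)
  have "card V = card L + card (V - L)"
    using L_V finite_V by (metis card_Diff_subset card_mono finite_subset le_add_diff_inverse)
  then have "odd (card L)" using True one by simp
  then show ?thesis
    using alon_tarsi_wheel_eq_4[OF c] True plane_tree_of_halin_decomp(2)[OF dec] by simp
next
  case False
  obtain T rho where dec: "halin_decomp V E T rho" using assms(2) unfolding halin_def by blast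
  interpret plane_tree V T rho by (rule plane_tree_of_halin_decomp[OF dec])
  have "card V = card L + card (V - L)"
    using L_V finite_V by (metis card_Diff_subset card_mono finite_subset le_add_diff_inverse)
  \<comment> \<open>\<open>wheel\<close> quantifies over all decompositions, so its failure applies
    to the one chosen here.\<close>
  moreover have "card (V - L) \<noteq> 1 \<or> odd (card V)"
    using False dec unfolding wheel_def by blast
  ultimately have "even (card L) \<or> card (V - L) \<noteq> 1" by auto
  then show ?thesis
    using alon_tarsi_eq_3 False plane_tree_of_halin_decomp(2)[OF dec] by simp
qed

end
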